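(* Let $F$ be a perfect field, $V=F^n$ a finite-dimensional vector space over $F$, and let $H$ be a finitely generated abelian subgroup of $GL(V)$. Then $M_{H}=M_{\langle H_s\rangle}$. In particular, if $G$ is a finitely generated subgroup of $GL(V)$ and $H$ is a finitely generated abelian subgroup of $G$, then $M_{\langle H_s\rangle}\leq M_G$.
   Context: For a subgroup $G\leq GL(V)$, $V=F^n$, the group $G$ acts on the polynomial algebra $F[V]=F[x_1,\ldots,x_n]$ by $(gf)(v)=f(g^{-1}v)$, and $F[V]^G$ denotes the algebra of invariant polynomials. With $F[V]_d$ the space of homogeneous polynomials of degree $d$, put $M_G=M_{G,V}=\min\{d>0 \mid F[V]_d^G\neq 0\}$, and $M_G=\infty$ if $F[V]^G=F$. Over a perfect field, every $g\in GL(V)$ has a Jordan-Chevalley decomposition $g=g_sg_u=g_ug_s$ in $GL(V)$ with $g_s$ semisimple and $g_u$ unipotent. $H_s=\{h_s\mid h\in H\}$ denotes the set of semisimple components of elements of $H$, and $\langle H_s\rangle$ is the subgroup of $GL(V)$ generated by $H_s$. *)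

theory Defs
  imports
    "HOL-Analysis.Cartesian_Space"
    "HOL-Analysis.Determinants"
    "HOL-Algebra.Generated_Groups"
    "HOL-Computational_Algebra.Polynomial_Factorial"
    "HOL-Library.Poly_Mapping"
    "HOL-Library.Extended_Nat"
begin

text \<open>A field is perfect if each of its irreducible polynomials is separable. Separability of
  \<open>p\<close> (distinct roots in a splitting field) is expressed as coprimality with the derivative.\<close>

definition perfect :: "'a::field itself \<Rightarrow> bool" where
  "perfect _ \<longleftrightarrow> (\<forall>p :: 'a poly. irreducible p \<longrightarrow> coprime p (pderiv p))"


definition GL :: "('a::field ^ 'n ^ 'n) monoid" where
  "GL = \<lparr>carrier = {g. invertible g}, monoid.mult = (**), one = mat 1\<rparr>"

definition fg_subgroup :: "('a::field ^ 'n ^ 'n) set \<Rightarrow> bool" where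
  "fg_subgroup H \<longleftrightarrow>
     subgroup H GL \<and> (\<exists>S. finite S \<and> S \<subseteq> carrier GL \<and> generate GL S = H)"

definition fg_abelian_subgroup :: "('a::field ^ 'n ^ 'n) set \<Rightarrow> bool" where
  "fg_abelian_subgroup H \<longleftrightarrow> fg_subgroup H \<and> comm_group (GL\<lparr>carrier := H\<rparr>)"


text \<open>Polynomials in the variables \<open>x\<^sub>i\<close> (\<open>i\<close> ranging over the finite index type \<open>'n\<close>) are formal:
  finitely supported coefficient functions on exponent vectors \<open>'n \<Rightarrow>\<^sub>0 nat\<close>, with the convolution
  product. They are not identified with functions on \<open>V\<close>, which matters over finite fields.\<close>

type_synonym ('a, 'n) mpoly = "('n \<Rightarrow>\<^sub>0 nat) \<Rightarrow>\<^sub>0 'a"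

definition Const :: "'a::field \<Rightarrow> ('a, 'n) mpoly" where
  "Const c = Poly_Mapping.single 0 c"

definition Var :: "'n \<Rightarrow> ('a::field, 'n) mpoly" where
  "Var i = Poly_Mapping.single (Poly_Mapping.single i 1) 1"

definition subst :: "('n \<Rightarrow> ('a, 'n) mpoly) \<Rightarrow> ('a::field, 'n::finite) mpoly \<Rightarrow> ('a, 'n) mpoly" where
  "subst \<sigma> f =
     (\<Sum>m \<in> Poly_Mapping.keys f.
        Const (Poly_Mapping.lookup f m) * (\<Prod>i\<in>UNIV. \<sigma> i ^ Poly_Mapping.lookup m i))"

text \<open>\<open>(g f)(v) = f(g\<^sup>-\<^sup>1 v)\<close>: the \<open>i\<close>-th coordinate of \<open>g\<^sup>-\<^sup>1 v\<close>, a linear form in \<open>v\<close>, is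
  substituted for \<open>x\<^sub>i\<close>.\<close>

definition act :: "'a::field ^ 'n ^ 'n \<Rightarrow> ('a, 'n::finite) mpoly \<Rightarrow> ('a, 'n) mpoly" where
  "act g = subst (\<lambda>i. \<Sum>j\<in>UNIV. Const (matrix_inv g $ i $ j) * Var j)"

text \<open>The zero polynomial is homogeneous of every degree.\<close>

definition homogeneous :: "nat \<Rightarrow> ('a::field, 'n::finite) mpoly \<Rightarrow> bool" where
  "homogeneous d f \<longleftrightarrow>
     (\<forall>m \<in> Poly_Mapping.keys f. (\<Sum>i\<in>UNIV. Poly_Mapping.lookup m i) = d)"

definition invariants :: "('a::field ^ 'n ^ 'n) set \<Rightarrow> ('a, 'n::finite) mpoly set" where
  "invariants G = {f. \<forall>g\<in>G. act g f = f}"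

definition invariants_deg ::
    "('a::field ^ 'n ^ 'n) set \<Rightarrow> nat \<Rightarrow> ('a, 'n::finite) mpoly set" where
  "invariants_deg G d = {f \<in> invariants G. homogeneous d f}"

definition M :: "('a::field ^ 'n::finite ^ 'n) set \<Rightarrow> enat" where
  "M G = (if invariants G = range Const then \<infinity>
          else enat (LEAST d. d > 0 \<and> invariants_deg G d \<noteq> {0}))"


definition invariant_subspace :: "'a::field ^ 'n ^ 'n \<Rightarrow> ('a ^ 'n::finite) set \<Rightarrow> bool" where
  "invariant_subspace g W \<longleftrightarrow> vec.subspace W \<and> (\<forall>w\<in>W. g *v w \<in> W)"

definition semisimple :: "'a::field ^ 'n::finite ^ 'n \<Rightarrow> bool" where
  "semisimple g \<longleftrightarrow>
     (\<forall>W. invariant_subspace g W \<longrightarrow>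
        (\<exists>W'. invariant_subspace g W' \<and> W \<inter> W' = {0} \<and> {w + w' | w w'. w \<in> W \<and> w' \<in> W'} = UNIV))"

text \<open>\<open>g - 1\<close> is nilpotent. Its powers are taken as iterates of the endomorphism, since \<open>^\<close> is not
  the power for the matrix product.\<close>

definition unipotent :: "'a::field ^ 'n::finite ^ 'n \<Rightarrow> bool" where
  "unipotent g \<longleftrightarrow> (\<exists>k. \<forall>v. (((*v) (g - mat 1)) ^^ k) v = 0)"

definition jordan_chevalley ::
    "'a::field ^ 'n::finite ^ 'n \<Rightarrow> 'a ^ 'n ^ 'n \<Rightarrow> 'a ^ 'n ^ 'n \<Rightarrow> bool" where
  "jordan_chevalley g s u \<longleftrightarrow>
     s \<in> carrier GL \<and> u \<in> carrier GL \<and> semisimple s \<and> unipotent u \<and> g = s ** u \<and> g = u ** s"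

text \<open>Over a perfect field every \<open>g\<close> in \<open>GL\<close> has exactly one such pair \<open>(s, u)\<close>, so this is the
  image of \<open>H\<close> under \<open>h \<mapsto> h\<^sub>s\<close>.\<close>

definition semisimple_parts :: "('a::field ^ 'n::finite ^ 'n) set \<Rightarrow> ('a ^ 'n ^ 'n) set" where
  "semisimple_parts H = {s. \<exists>h\<in>H. \<exists>u. jordan_chevalley h s u}"

end

theory Submission
  imports "HOL-Algebra.Algebraic_Closure_Type" Defs
begin

text \<open>
  Let \<open>h = s u\<close> be a Jordan-Chevalley decomposition. If \<open>h\<close> fixes a polynomial \<open>f\<close>, then \<open>s\<close> acts on
  \<open>f\<close> as \<open>u\<^sup>-\<^sup>1\<close> does, so some power of \<open>s - 1\<close> kills \<open>f\<close>. Over the algebraic closure \<open>s\<close> is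
  diagonalizable on linear forms, and sums of eigenvectors form a subring, so \<open>f\<close> is a sum of
  eigenvectors of \<open>s\<close>; hence \<open>s\<close> fixes \<open>f\<close>. Thus invariants of \<open>H\<close> are invariants of \<open>H\<^sub>s\<close>.
  Conversely, \<open>s\<close> is a polynomial in \<open>h\<close>, so \<open>H\<close> commutes with \<open>H\<^sub>s\<close> and acts on the
  \<open>H\<^sub>s\<close>-invariants of a given degree by commuting unipotent operators; these have a common nonzero
  fixed vector as soon as there is any nonzero \<open>H\<^sub>s\<close>-invariant.
\<close>

section \<open>Separable polynomials\<close>

text \<open>If \<open>H\<close> is unipotent, its semisimple parts are trivial and fix every
  polynomial, so the two invariant rings may differ; only the degrees that carry nonzero invariants
  can be compared. Hence one half of the argument gives an inclusion and the other merely a nonzero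
  vector, which finite generation allows to be built one generator at a time. The obstacle is that
  \<open>semisimple\<close> speaks of complements over the ground field, while eigenvectors may
  exist only over its closure. The bridge is a polynomial \<open>q\<close> with q(s) = 0 that is
  coprime to its derivative: perfectness provides it, and its Bezout identity survives extension of
  scalars. The same \<open>q\<close> governs the Jordan-Chevalley decomposition: Newton iteration
  turns \<open>h\<close> into a root r(h) of \<open>q\<close>, and a root of \<open>q\<close> is
  unique among commuting operators with nilpotent difference, so r(h) is the given
  \<open>s\<close>.\<close>

text \<open>Stated as a Bezout identity, which is preserved by field extensions.\<close>

definition separable_poly :: "'a::field poly \<Rightarrow> bool" where
  "separable_poly p \<longleftrightarrow> (\<exists>a b. a * p + b * pderiv p = 1)"

text \<open>Extended Euclidean algorithm. The induction measure ranks \<open>q = 0\<close> strictly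
  below the nonzero constants, which also have degree 0, so that the last division step still
  decreases it.\<close>

lemma coprime_field_poly_bezout:
  fixes p q :: "'a::field poly"
  assumes "coprime p q"
  shows "\<exists>a b. a * p + b * q = 1"
  using assms
proof (induction "if q = 0 then 0 else Suc (degree q)" arbitrary: p q rule: less_induct)
  case less
  show ?case
  proof (cases "q = 0")
    case True
    with less.prems have "p dvd 1" by simp
    then obtain c where "1 = p * c" by (rule dvdE)
    then have "c * p + 0 * q = 1" by (simp add: mult.commute)
    then show ?thesis by blast
  next
    case False
    have cop: "coprime q (p mod q)"
      using less.prems by (simp add: coprime_commute coprime_mod_right_iff False)
    have lt: "(if p mod q = 0 then 0 else Suc (degree (p mod q))) < (if q = 0 then 0 else Suc (degree q))"
      using False degree_mod_less[of q p] by auto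
    obtain a b where ab: "a * q + b * (p mod q) = 1"
      using less.hyps[OF lt cop] by blast
    have "b * p + (a - b * (p div q)) * q = a * q + b * (p - p div q * q)"
      by (simp add: algebra_simps)
    also have "\<dots> = 1" using ab by (simp add: minus_div_mult_eq_mod)
    finally show ?thesis by blast
  qed
qed

lemma separable_poly_iff_coprime: "separable_poly p \<longleftrightarrow> coprime p (pderiv p)"
proof
  assume "separable_poly p"
  then obtain a b where ab: "a * p + b * pderiv p = 1" by (auto simp: separable_poly_def)
  show "coprime p (pderiv p)"
  proof (rule coprimeI)
    fix c assume "c dvd p" "c dvd pderiv p"
    then have "c dvd a * p + b * pderiv p" by simp
    with ab show "is_unit c" by simp
  qed
qed (auto simp: separable_poly_def intro: coprime_field_poly_bezout)

lemma separable_poly_1 [simp]: "separable_poly 1"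
  unfolding separable_poly_def by (intro exI[of _ 1] exI[of _ 0]) simp

text \<open>After the product rule every term of the Bezout identity is divisible by
  \<open>p\<close> or by \<open>t * pderiv p\<close>; two ways of grouping the terms give the two
  claims. The second one excludes repeated factors.\<close>

lemma separable_poly_multD:
  assumes "separable_poly (p * t)"
  shows "separable_poly p" and "\<exists>a b. a * p + b * t = 1"
proof -
  obtain a b where ab: "a * (p * t) + b * pderiv (p * t) = 1"
    using assms by (auto simp: separable_poly_def)
  have "(a * t + b * pderiv t) * p + (b * t) * pderiv p = 1"
    using ab by (simp add: pderiv_mult algebra_simps)
  then show "separable_poly p" unfolding separable_poly_def by blast
  have "(a * t + b * pderiv t) * p + (b * pderiv p) * t = 1"
    using ab by (simp add: pderiv_mult algebra_simps)
  then show "\<exists>a b. a * p + b * t = 1" by blast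
qed

section \<open>Irreducible factors and separable radicals\<close>

lemma field_poly_irreducible_factor:
  fixes p :: "'a::field poly"
  assumes "degree p > 0"
  shows "\<exists>f g. irreducible f \<and> p = f * g"
  using assms
proof (induction "degree p" arbitrary: p rule: less_induct)
  case less
  show ?case
  proof (cases "irreducible p")
    case True
    then show ?thesis by (intro exI[of _ p] exI[of _ 1]) simp
  next
    case False
    then obtain a b where ab: "p = a * b" "\<not> is_unit a" "\<not> is_unit b"
      using less.prems by (auto simp: irreducible_def is_unit_poly_iff)
    have nz: "a \<noteq> 0" "b \<noteq> 0" using less.prems ab by auto
    then have da: "degree a > 0" "degree b > 0" using ab by (auto simp: is_unit_iff_degree)
    have "degree a < degree p" using nz da ab by (simp add: degree_mult_eq)
    from less.hyps[OF this da(1)] obtain f g where "irreducible f" "a = f * g" by blast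
    then have "irreducible f \<and> p = f * (g * b)" using ab by simp
    then show ?thesis by blast
  qed
qed

lemma irreducible_imp_coprime:
  fixes p q :: "'a::field poly"
  assumes "irreducible p" "\<not> p dvd q"
  shows "coprime p q"
proof (rule coprimeI)
  fix c assume c: "c dvd p" "c dvd q"
  show "is_unit c"
    using assms c by (meson dvd_trans irreducibleD')
qed

lemma coprime_mult_field_poly:
  fixes f g h :: "'a::field poly"
  assumes "coprime f g" "coprime f h"
  shows "coprime f (g * h)"
proof -
  obtain a b where ab: "a * f + b * g = 1" using coprime_field_poly_bezout[OF assms(1)] by blast
  show ?thesis
  proof (rule coprimeI)
    fix c assume c: "c dvd f" "c dvd g * h"
    have "h = a * f * h + b * (g * h)" using ab by (metis mult_1 distrib_right mult.assoc)
    moreover have "c dvd a * f * h + b * (g * h)"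
      using c by (intro dvd_add) auto
    ultimately have "c dvd h" by simp
    with c(1) show "is_unit c" using assms(2) by (meson coprime_common_divisor)
  qed
qed

lemma coprime_add_multiple_field_poly:
  fixes f g :: "'a::field poly"
  assumes "coprime f g"
  shows "coprime f (f * x + g)"
proof (rule coprimeI)
  fix c assume c: "c dvd f" "c dvd f * x + g"
  then have "c dvd g" by (simp add: dvd_add_right_iff)
  with c(1) show "is_unit c" using assms by (meson coprime_common_divisor)
qed

text \<open>An irreducible factor \<open>f\<close> of \<open>m\<close> either divides the
  \<open>q\<close> found for the cofactor, and only the exponent grows, or it is new, and
  \<open>f * q\<close> stays separable. Perfectness enters through
  \<open>coprime f (pderiv f)\<close>; nowhere else is it unfolded.\<close>

lemma perfect_separable_radical:
  fixes m :: "'a::field poly"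
  assumes perf: "perfect TYPE('a)" and "m \<noteq> 0"
  shows "\<exists>q k. separable_poly q \<and> m dvd q ^ k"
  using \<open>m \<noteq> 0\<close>
proof (induction "degree m" arbitrary: m rule: less_induct)
  case less
  show ?case
  proof (cases "degree m = 0")
    case True
    then have "m dvd 1 ^ 0" using less.prems by (simp add: is_unit_iff_degree)
    then show ?thesis using separable_poly_1 by blast
  next
    case False
    then obtain f g where fg: "irreducible f" "m = f * g"
      using field_poly_irreducible_factor by blast
    have nz: "f \<noteq> 0" "g \<noteq> 0" using fg less.prems by auto
    have "degree f > 0" using fg(1) nz by (auto simp: irreducible_def is_unit_iff_degree)
    then have "degree g < degree m" using nz fg by (simp add: degree_mult_eq)
    from less.hyps[OF this nz(2)] obtain q k where q: "separable_poly q" "g dvd q ^ k" by blast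
    show ?thesis
    proof (cases "f dvd q")
      case True
      have "m dvd q ^ Suc k" using fg q True by (simp add: mult_dvd_mono)
      then show ?thesis using q by blast
    next
      case False
      have 1: "coprime f q" by (rule irreducible_imp_coprime[OF fg(1) False])
      have 2: "coprime f (pderiv f)" using perf fg(1) by (simp add: perfect_def)
      have 3: "coprime q (pderiv q)" using q(1) by (simp add: separable_poly_iff_coprime)
      \<comment> \<open>Modulo \<open>f\<close> the derivative of \<open>f * q\<close> is
        \<open>pderiv f * q\<close>, modulo \<open>q\<close> it is \<open>f * pderiv q\<close>; both
        are units there.\<close>
      have c1: "coprime f (f * pderiv q + pderiv f * q)"
        by (intro coprime_add_multiple_field_poly coprime_mult_field_poly 1 2)
      have c2: "coprime q (q * pderiv f + f * pderiv q)"
        using 1 by (intro coprime_add_multiple_field_poly coprime_mult_field_poly 3)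
                   (simp add: coprime_commute)
      have "separable_poly (f * q)"
        unfolding separable_poly_iff_coprime pderiv_mult
        using coprime_mult_field_poly[of "f * pderiv q + q * pderiv f" f q] c1 c2
        by (simp only: coprime_commute[of _ "f * pderiv q + q * pderiv f"] mult.commute[of "pderiv f" q] add.commute[of "q * pderiv f"])
      moreover have "m dvd (f * q) ^ Suc k"
        using fg q by (simp add: power_mult_distrib mult_dvd_mono dvd_mult)
      ultimately show ?thesis by blast
    qed
  qed
qed

text \<open>The second-order remainder is left as an unspecified multiple of
  \<open>d\<^sup>2\<close>, so no factorial is divided by and the characteristic is
  arbitrary.\<close>

lemma pcompose_taylor:
  fixes q :: "'a::field poly"
  shows "\<exists>z. pcompose q (r + d) = pcompose q r + d * pcompose (pderiv q) r + d\<^sup>2 * z"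
proof (induction q)
  case 0
  show ?case by (intro exI[of _ 0]) simp
next
  case (pCons c q)
  then obtain z where z: "pcompose q (r + d) = pcompose q r + d * pcompose (pderiv q) r + d\<^sup>2 * z"
    by blast
  show ?case
    unfolding pcompose_pCons z
    by (rule exI[of _ "(r + d) * z + pcompose (pderiv q) r"])
       (simp add: pcompose_pCons pderiv_pCons pcompose_add algebra_simps power2_eq_square)
qed

text \<open>Newton iteration, started at the approximate root \<open>X\<close> of \<open>q\<close> modulo \<open>q\<close>.\<close>

lemma separable_poly_newton:
  assumes "separable_poly q"
  shows "\<exists>r. q ^ k dvd pcompose q r \<and> q dvd r - [:0, 1:]"
proof -
  obtain a b where ab: "a * q + b * pderiv q = 1" using assms by (auto simp: separable_poly_def)
  \<comment> \<open>With exponent \<open>Suc k\<close> the induction hypothesis always contains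
    \<open>q dvd pcompose q r\<close>, which preserves the congruence of \<open>r\<close> with
    X.\<close>
  have "\<exists>r. q ^ Suc k dvd pcompose q r \<and> q dvd r - [:0, 1:]"
  proof (induction k)
    case 0
    show ?case by (rule exI[of _ "[:0, 1:]"]) (simp add: pcompose_idR)
  next
    case (Suc k)
    then obtain r where r: "q ^ Suc k dvd pcompose q r" "q dvd r - [:0, 1:]" by blast
    define Q A B where "Q = pcompose q r" and "A = pcompose a r" and "B = pcompose b r"
    define Q' where "Q' = pcompose (pderiv q) r"
    have AB: "A * Q + B * Q' = 1"
      using arg_cong[OF ab, of "\<lambda>p. pcompose p r"]
      by (simp add: Q_def A_def B_def Q'_def pcompose_add pcompose_mult pcompose_1)
    \<comment> \<open>The Newton correction: \<open>B\<close> inverts \<open>Q'\<close> modulo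
      \<open>Q\<close>, so \<open>Q * B\<close> stands for q(r) / q'(r), and the first-order terms
      cancel up to a multiple of \<open>Q\<^sup>2\<close>.\<close>
    obtain z where z: "pcompose q (r + - (Q * B)) = Q + - (Q * B) * Q' + (- (Q * B))\<^sup>2 * z"
      using pcompose_taylor[of q r "- (Q * B)"] unfolding Q_def Q'_def by blast
    have "B * Q' = 1 - A * Q" using AB by (simp add: algebra_simps)
    have "pcompose q (r - Q * B) = Q - Q * (B * Q') + (Q * B)\<^sup>2 * z"
      using z by (simp add: mult.assoc)
    also have "\<dots> = Q\<^sup>2 * (A + B\<^sup>2 * z)"
      unfolding \<open>B * Q' = 1 - A * Q\<close> by (simp add: algebra_simps power2_eq_square)
    finally have "pcompose q (r - Q * B) = Q\<^sup>2 * (A + B\<^sup>2 * z)" .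
    moreover have "q ^ Suc (Suc k) dvd Q\<^sup>2"
    proof -
      have "(q ^ Suc k)\<^sup>2 dvd Q\<^sup>2" using r(1) by (simp add: Q_def dvd_power_same)
      moreover have "q ^ Suc (Suc k) dvd (q ^ Suc k)\<^sup>2"
        unfolding power_mult[symmetric] by (rule le_imp_power_dvd) simp
      ultimately show ?thesis by (rule dvd_trans[rotated])
    qed
    ultimately have 1: "q ^ Suc (Suc k) dvd pcompose q (r - Q * B)" by simp
    have "q dvd q ^ Suc k" by simp
    then have "q dvd Q" using r(1) unfolding Q_def by (rule dvd_trans)
    then have "q dvd (r - [:0, 1:]) - Q * B" using r(2) dvd_diff dvd_mult2 by blast
    then have "q dvd (r - Q * B) - [:0, 1:]" by (simp add: algebra_simps)
    with 1 show ?case by blast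
  qed
  then show ?thesis by (meson dvd_trans le_imp_power_dvd lessI less_imp_le)
qed

section \<open>Polynomials in a linear operator\<close>

text \<open>One calculus for column vectors, row vectors and polynomial rings over the field and
  over its closure. Polynomial rings are infinite-dimensional, so no bound on the dimension is built
  in.\<close>

locale lin_op = vector_space scale
  for scale :: "'a::field \<Rightarrow> 'b::ab_group_add \<Rightarrow> 'b" (infixr "*s" 75) +
  fixes T :: "'b \<Rightarrow> 'b"
  assumes T_add: "T (v + w) = T v + T w" and T_scale: "T (c *s v) = c *s T v"
begin

definition pev :: "'a poly \<Rightarrow> 'b \<Rightarrow> 'b" where
  "pev p v = foldr (\<lambda>a w. a *s v + T w) (coeffs p) 0"

lemma T_0 [simp]: "T 0 = 0"
  using T_add[of 0 0] by simp

lemma T_minus: "T (- v) = - T v"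
  using T_add[of v "- v"] by (simp add: eq_neg_iff_add_eq_0 add.commute)

lemma T_diff: "T (v - w) = T v - T w"
  using T_add[of v "- w"] by (simp add: T_minus)

lemma pev_0 [simp]: "pev 0 v = 0"
  by (simp add: pev_def)

lemma pev_pCons [simp]: "pev (pCons a p) v = a *s v + T (pev p v)"
  by (simp add: pev_def cCons_def)

lemma pev_1 [simp]: "pev 1 v = v"
  by (simp add: one_pCons)

lemma pev_vadd: "pev p (v + w) = pev p v + pev p w"
  by (induction p) (auto simp: scale_right_distrib T_add algebra_simps)

lemma pev_vscale: "pev p (c *s v) = c *s pev p v"
  by (induction p) (auto simp: scale_right_distrib T_scale mult.commute)

lemma pev_T: "pev p (T v) = T (pev p v)"
  by (induction p) (auto simp: T_add T_scale)

lemma lin_op_pev: "lin_op scale (pev p)"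
  by unfold_locales (auto simp: pev_vadd pev_vscale)

lemma pev_v0 [simp]: "pev p 0 = 0"
  using pev_vadd[of p 0 0] by simp

lemma pev_vdiff: "pev p (v - w) = pev p v - pev p w"
  by (rule lin_op.T_diff[OF lin_op_pev])

lemma pev_add: "pev (p + q) v = pev p v + pev q v"
  by (induction p q rule: poly_induct2) (auto simp: scale_left_distrib T_add algebra_simps)

lemma pev_smult: "pev (smult c p) v = c *s pev p v"
  by (induction p) (auto simp: scale_right_distrib T_scale)

lemma pev_minus: "pev (- p) v = - pev p v"
  using pev_add[of p "- p" v] by (simp add: eq_neg_iff_add_eq_0 add.commute)

lemma pev_diff: "pev (p - q) v = pev p v - pev q v"
  using pev_add[of p "- q" v] by (simp add: pev_minus)

lemma pev_mult: "pev (p * q) v = pev p (pev q v)"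
  by (induction p) (auto simp: pev_add pev_smult)

lemma pev_mult': "pev (p * q) v = pev q (pev p v)"
  by (metis pev_mult mult.commute)

lemma pev_dvd: "q dvd p \<Longrightarrow> pev q v = 0 \<Longrightarrow> pev p v = 0"
  by (elim dvdE) (simp add: pev_mult')

text \<open>Through this rule a divisibility such as \<open>q ^ k dvd pcompose q r\<close> becomes a
  statement about the value of \<open>q\<close> at the operator r(T).\<close>

lemma pev_pcompose: "pev (pcompose p r) v = lin_op.pev scale (pev r) p v"
proof -
  interpret R: lin_op scale "pev r" by (rule lin_op_pev)
  show ?thesis by (induction p) (auto simp: pcompose_pCons pev_add pev_mult)
qed

lemma pev_linear: "pev [:- c, 1:] v = T v - c *s v"
  by simp

lemma pev_linear_power: "pev ([:- c, 1:] ^ k) v = ((\<lambda>v. T v - c *s v) ^^ k) v"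
proof (induction k)
  case (Suc k)
  have "pev ([:- c, 1:] ^ Suc k) v = pev [:- c, 1:] (pev ([:- c, 1:] ^ k) v)"
    by (simp only: power_Suc pev_mult)
  then show ?case using Suc by simp
qed simp

lemma pev_eigen: "T v = c *s v \<Longrightarrow> pev p v = poly p c *s v"
  by (induction p) (auto simp: T_scale scale_left_distrib mult.commute)

lemma pev_subspace:
  assumes "subspace W" "\<And>w. w \<in> W \<Longrightarrow> T w \<in> W" "w \<in> W"
  shows "pev p w \<in> W"
  using assms(1) by (induction p) (auto intro: subspace_0 subspace_add subspace_scale assms)

section \<open>Eigenvectors and generalized eigenvectors\<close>

definition eigenvectors :: "'b set" where
  "eigenvectors = {v. \<exists>c. T v = c *s v}"

text \<open>Two products of distinct linear factors both divide the product over the union of their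
  roots, so the vectors killed by some such product form a subspace. Indexing by a set keeps the
  factors distinct.\<close>

lemma span_eigenvectors_killed:
  assumes "v \<in> span eigenvectors"
  shows "\<exists>L. finite L \<and> pev (\<Prod>c\<in>L. [:- c, 1:]) v = 0"
proof -
  let ?P = "\<lambda>L. \<Prod>c\<in>L. [:- c, 1:]"
  have sub: "subspace {v. \<exists>L. finite L \<and> pev (?P L) v = 0}"
  proof (rule subspaceI, safe)
    show "\<exists>L. finite L \<and> pev (?P L) 0 = 0" by (rule exI[of _ "{}"]) simp
    show "\<exists>L. finite L \<and> pev (?P L) (c *s v) = 0" if "finite L" "pev (?P L) v = 0" for c v L
      using that by (intro exI[of _ L]) (simp add: pev_vscale)
    fix v w L1 L2 assume fin: "finite L1" "finite L2" and 0: "pev (?P L1) v = 0" "pev (?P L2) w = 0"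
    have "?P L1 dvd ?P (L1 \<union> L2)" "?P L2 dvd ?P (L1 \<union> L2)"
      using fin by (auto intro: prod_dvd_prod_subset)
    with 0 have "pev (?P (L1 \<union> L2)) (v + w) = 0" by (simp add: pev_vadd pev_dvd)
    with fin show "\<exists>L. finite L \<and> pev (?P L) (v + w) = 0" by blast
  qed
  have "eigenvectors \<subseteq> {v. \<exists>L. finite L \<and> pev (?P L) v = 0}"
  proof
    fix v assume "v \<in> eigenvectors"
    then obtain c where "T v = c *s v" by (auto simp: eigenvectors_def)
    then have "pev (?P {c}) v = 0" by simp
    then show "v \<in> {v. \<exists>L. finite L \<and> pev (?P L) v = 0}" by blast
  qed
  from span_minimal[OF this sub] assms show ?thesis by blast
qed

text \<open>By induction (T - c) v vanishes, so p(T) acts on \<open>v\<close> as the nonzero scalar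
  p(c).\<close>

lemma pev_coprime_linear_power:
  assumes "pev p v = 0" "poly p c \<noteq> 0" "pev ([:- c, 1:] ^ k) v = 0"
  shows "v = 0"
  using assms(1,3)
proof (induction k arbitrary: v)
  case (Suc k)
  have "pev [:- c, 1:] v = 0"
  proof (rule Suc.IH)
    show "pev p (pev [:- c, 1:] v) = 0"
      using Suc.prems(1) by (metis pev_mult pev_mult' pev_v0)
    show "pev ([:- c, 1:] ^ k) (pev [:- c, 1:] v) = 0"
      using Suc.prems(2) by (metis pev_mult power_Suc2)
  qed
  then have Tv: "T v = c *s v" by simp
  from Suc.prems(1) have "poly p c *s v = 0" unfolding pev_eigen[OF Tv] .
  with assms(2) show "v = 0" by simp
qed simp

text \<open>The squarefree product killing \<open>v\<close> contains X - c at most once, and its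
  other factors are nonzero at c, so the preceding lemma applies to (T - c) v. In short,
  diagonalizability excludes Jordan blocks.\<close>

lemma span_eigenvectors_generalized_eigenvector:
  assumes "v \<in> span eigenvectors" "pev ([:- c, 1:] ^ k) v = 0"
  shows "T v = c *s v"
proof -
  obtain L where L: "finite L" "pev (\<Prod>c\<in>L. [:- c, 1:]) v = 0"
    using span_eigenvectors_killed[OF assms(1)] by blast
  let ?p = "\<Prod>a\<in>L - {c}. [:- a, 1:]"
  have "(\<Prod>c\<in>L. [:- c, 1:]) dvd ?p * [:- c, 1:]"
  proof (cases "c \<in> L")
    case True
    then show ?thesis using L(1) by (simp only: prod.remove[of L c] mult.commute dvd_refl)
  next
    case False
    then have "L - {c} = L" by blast
    then show ?thesis by (simp only: dvd_triv_left)
  qed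
  then have "pev (?p * [:- c, 1:]) v = 0" using L(2) by (rule pev_dvd)
  then have 1: "pev ?p (pev [:- c, 1:] v) = 0" by (simp only: pev_mult)
  have 2: "poly ?p c \<noteq> 0" using L(1) by (simp add: poly_prod)
  have 3: "pev ([:- c, 1:] ^ k) (pev [:- c, 1:] v) = 0"
    using assms(2) by (metis pev_mult pev_mult' pev_v0)
  have "pev [:- c, 1:] v = 0" by (rule pev_coprime_linear_power[OF 1 2 3])
  then show ?thesis by simp
qed

text \<open>The remainder \<open>Z\<close> is only asserted to exist as a function: it need not commute with anything
  to exploit it in \<open>separable_root_unique\<close>.\<close>

lemma pev_taylor:
  assumes S: "lin_op scale S" and comm: "\<And>v. S (T v) = T (S v)"
  shows "\<exists>Z. \<forall>v. lin_op.pev scale S q v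
           = pev q v + (S (pev (pderiv q) v) - T (pev (pderiv q) v))
             + (let w = S (Z v) - T (Z v) in S w - T w)"
proof -
  interpret S: lin_op scale S by (rule S)
  show ?thesis
  proof (induction q)
    case 0
    show ?case by (rule exI[of _ "\<lambda>_. 0"]) simp
  next
    case (pCons c q)
    then obtain Z where Z: "\<And>v. S.pev q v = pev q v + (S (pev (pderiv q) v) - T (pev (pderiv q) v))
             + (let w = S (Z v) - T (Z v) in S w - T w)" by blast
    show ?case
      \<comment> \<open>With N = S - T, the term S N q'(T) v equals N T q'(T) v + N^2 q'(T) v. Its
        last summand joins \<open>S\<close> applied to the old remainder.\<close>
      by (rule exI[of _ "\<lambda>v. S (Z v) + pev (pderiv q) v"])
         (simp add: Z Let_def pderiv_pCons pev_add T_add T_diff S.T_add S.T_diff comm algebra_simps)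
  qed
qed

text \<open>With N = S - T, expanding q(S) at T leaves N q'(T) + N^2 Z = 0, and b(T) inverts q'(T)
  because q(T) = 0. Hence N factors through N^2, and a vanishing power of N forces the preceding
  power to vanish, down to N itself.\<close>

lemma separable_root_unique:
  assumes S: "lin_op scale S" and comm: "\<And>v. S (T v) = T (S v)"
    and q: "separable_poly q"
    and qT: "\<And>v. pev q v = 0" and qS: "\<And>v. lin_op.pev scale S q v = 0"
    and nil: "\<And>v. ((\<lambda>v. S v - T v) ^^ k) v = 0"
  shows "S v = T v"
proof -
  interpret S: lin_op scale S by (rule S)
  define N where "N = (\<lambda>v. S v - T v)"
  interpret N: lin_op scale N
    by unfold_locales (auto simp: N_def T_add S.T_add T_scale S.T_scale algebra_simps)
  obtain a b where ab: "a * q + b * pderiv q = 1" using q by (auto simp: separable_poly_def)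
  obtain Z where Z: "\<And>v. S.pev q v = pev q v + (S (pev (pderiv q) v) - T (pev (pderiv q) v))
             + (let w = S (Z v) - T (Z v) in S w - T w)"
    using pev_taylor[OF S comm] by blast
  have N: "N v = N (N (- Z (pev b v)))" for v
  proof -
    have "pev (pderiv q) (pev b v) = pev (b * pderiv q) v" by (simp add: pev_mult')
    also have "\<dots> = pev (a * q + b * pderiv q) v" by (simp add: pev_add pev_mult qT)
    also have "\<dots> = v" by (simp add: ab)
    finally have 1: "pev (pderiv q) (pev b v) = v" .
    have "0 = N v + N (N (Z (pev b v)))"
      using Z[of "pev b v"] by (simp add: qS qT 1 Let_def N_def)
    then show ?thesis by (simp add: N.T_minus eq_neg_iff_add_eq_0)
  qed
  have "\<forall>v. (N ^^ Suc j) v = 0" if "\<forall>v. (N ^^ Suc (j + i)) v = 0" for i j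
    using that
  proof (induction i)
    case (Suc i)
    have "(N ^^ Suc (j + i)) v = 0" for v
    proof -
      have "(N ^^ Suc (j + i)) v = (N ^^ (j + i)) (N v)" by (simp add: funpow_swap1)
      also have "\<dots> = (N ^^ (j + i)) (N (N (- Z (pev b v))))" using N[of v] by simp
      also have "\<dots> = (N ^^ Suc (j + Suc i)) (- Z (pev b v))" by (simp add: funpow_swap1)
      finally show ?thesis using Suc.prems by simp
    qed
    then show ?case using Suc.IH by blast
  qed simp
  moreover have "(N ^^ Suc (0 + k)) v = 0" for v
    using nil[folded N_def] by simp
  ultimately have "(N ^^ Suc 0) v = 0" by blast
  then show ?thesis by (simp add: N_def)
qed

end

text \<open>A root c gives q = (X - c) p with coprime factors. Their Bezout identity splits
  \<open>v\<close> into a part killed by \<open>p\<close>, covered by induction, and an eigenvector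
  for c. The hypothesis \<open>split\<close> expresses algebraic closedness, as the locale fixes
  only a field.\<close>

lemma (in lin_op) separable_eigenvector_decomposition:
  fixes q :: "'a poly"
  assumes split: "\<And>p :: 'a poly. degree p > 0 \<Longrightarrow> \<exists>x. poly p x = 0"
    and "separable_poly q" "pev q v = 0"
  shows "v \<in> span eigenvectors"
  using assms(2-)
proof (induction "degree q" arbitrary: q v)
  case 0
  then obtain c where c: "q = [:c:]" by (metis degree_eq_zeroE)
  with 0 have "c \<noteq> 0" by (auto simp: separable_poly_def)
  with c 0 have "v = 0" by simp
  then show ?case by (simp add: span_zero)
next
  case (Suc n)
  then obtain c where "poly q c = 0" using split[of q] by auto
  then obtain p where p: "q = [:- c, 1:] * p" by (auto simp: poly_eq_0_iff_dvd elim: dvdE)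
  have sep: "separable_poly p" "separable_poly ([:- c, 1:] * p)"
    using separable_poly_multD(1)[of p "[:- c, 1:]"] Suc.prems(1) p by (simp_all only: mult.commute)
  obtain a b where ab: "a * [:- c, 1:] + b * p = 1"
    using separable_poly_multD(2)[OF sep(2)] by blast
  have "p \<noteq> 0" using p Suc.hyps(2) by auto
  then have "Suc (degree p) = degree q" unfolding p by (subst degree_mult_eq) auto
  then have deg: "n = degree p" using Suc.hyps(2) by simp
  have "pev p (pev (a * [:- c, 1:]) v) = pev (a * q) v"
    unfolding p by (simp only: pev_mult[symmetric] mult_ac)
  also have "\<dots> = 0" using Suc.prems(2) by (simp only: pev_mult pev_v0)
  finally have 1: "pev (a * [:- c, 1:]) v \<in> span eigenvectors" by (rule Suc.hyps(1)[OF deg sep(1)])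
  have "pev [:- c, 1:] (pev (b * p) v) = pev (b * q) v"
    unfolding p by (simp only: pev_mult[symmetric] mult_ac)
  also have "\<dots> = 0" using Suc.prems(2) by (simp only: pev_mult pev_v0)
  finally have "pev (b * p) v \<in> eigenvectors" by (auto simp: eigenvectors_def)
  then have 2: "pev (b * p) v \<in> span eigenvectors" by (rule span_base)
  have "v = pev (a * [:- c, 1:]) v + pev (b * p) v"
    by (simp only: pev_add[symmetric] ab pev_1)
  then show ?case using span_add[OF 1 2] by simp
qed

text \<open>Here \<open>U\<close> is semilinear along \<open>\<sigma>\<close>. Taking
  \<open>\<sigma>\<close> to be the inclusion into the closure gives extension of scalars, taking
  the identity gives plain commutation.\<close>

lemma pev_intertwine:
  assumes "lin_op s1 T1" "lin_op s2 T2"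
    and add: "\<And>v w. U (v + w) = U v + U w"
    and hom: "\<sigma> 0 = 0" "\<And>c v. U (s1 c v) = s2 (\<sigma> c) (U v)"
    and comm: "\<And>v. U (T1 v) = T2 (U v)"
  shows "U (lin_op.pev s1 T1 p v) = lin_op.pev s2 T2 (map_poly \<sigma> p) (U v)"
proof -
  interpret A: lin_op s1 T1 by fact
  interpret B: lin_op s2 T2 by fact
  have [simp]: "U 0 = 0" using add[of 0 0] by simp
  show ?thesis
  proof (induction p)
    case (pCons a p)
    then show ?case by (simp add: map_poly_pCons hom add comm)
  qed simp
qed

lemma pev_commute:
  assumes "lin_op s T" "lin_op s U" "\<And>v. U (T v) = T (U v)"
  shows "U (lin_op.pev s T p v) = lin_op.pev s T p (U v)"
  using pev_intertwine[OF assms(1) assms(1), of U "\<lambda>c. c" p v] assms(2,3)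
  by (simp add: lin_op.T_add lin_op.T_scale)

text \<open>Each Horner step moves one \<open>T1\<close> across the pairing as \<open>T2\<close>,
  which commutes with p(T2). It serves to carry annihilating polynomials from columns to
  rows.\<close>

lemma pev_adjoint:
  assumes "lin_op s1 T1" "lin_op s2 T2"
    and add1: "\<And>r r' v. B (r + r') v = B r v + B r' v" and add2: "\<And>r v v'. B r (v + v') = B r v + B r v'"
    and scale: "\<And>c r v. B (s1 c r) v = c * B r v" "\<And>c r v. B r (s2 c v) = c * B r v"
    and adj: "\<And>r v. B (T1 r) v = B r (T2 v)"
  shows "B (lin_op.pev s1 T1 p r) v = B r (lin_op.pev s2 T2 p v)"
proof -
  interpret A: lin_op s1 T1 by fact
  interpret B: lin_op s2 T2 by fact
  have [simp]: "B 0 v = 0" "B r 0 = 0" for r v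
    using scale(1)[of 0 0 v] scale(2)[of r 0 0] by simp_all
  show ?thesis
  proof (induction p arbitrary: v)
    case (pCons a p)
    then show ?case by (simp add: add1 add2 scale adj B.pev_T)
  qed simp
qed

section \<open>Semisimple matrices\<close>

interpretation mv: lin_op "(*s)" "(*v) A" for A :: "'a::field ^ 'n::finite ^ 'n"
  by unfold_locales (simp_all add: matrix_vector_right_distrib vector_scalar_commute)

lemma matrix_eq_pev:
  fixes h :: "'a::field ^ 'n::finite ^ 'n"
  shows "\<exists>s :: 'a ^ 'n ^ 'n. \<forall>v. s *v v = mv.pev h r v"
proof -
  have "Vector_Spaces.linear (*s) (*s) (mv.pev h r)"
    by unfold_locales (auto simp: mv.pev_vadd mv.pev_vscale)
  then show ?thesis using matrix_works by blast
qed

lemma invariant_subspace_pev: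
  assumes "invariant_subspace g W" "w \<in> W"
  shows "mv.pev g p w \<in> W"
  using assms by (intro mv.pev_subspace) (auto simp: invariant_subspace_def)

lemma annihilating_poly_vector:
  fixes h :: "'a::field ^ 'n::finite ^ 'n"
  shows "\<exists>p. p \<noteq> 0 \<and> mv.pev h p v = 0"
proof -
  define f where "f i = mv.pev h (monom 1 i) v" for i :: nat
  let ?I = "{..CARD('n)}"
  show ?thesis
  \<comment> \<open>Dependence is a property of sets, so a repetition among the iterates h^i v is
    treated apart; it gives the polynomial X^i - X^j. Without repetition there are too many iterates
    to be independent.\<close>
  proof (cases "inj_on f ?I")
    case False
    then obtain i j where ij: "i \<noteq> j" "f i = f j" by (auto simp: inj_on_def)
    have "monom (1::'a) i - monom 1 j \<noteq> 0"
      using ij(1) by (simp add: monom_eq_iff')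
    moreover have "mv.pev h (monom 1 i - monom 1 j) v = 0"
      using ij(2) by (simp add: mv.pev_diff f_def)
    ultimately show ?thesis by blast
  next
    case True
    then have "card (f ` ?I) = Suc (CARD('n))" by (simp add: card_image)
    moreover have "vec.dim (f ` ?I) \<le> CARD('n)" by (rule dim_subset_UNIV_cart_gen)
    ultimately have "vec.dependent (f ` ?I)"
      using vec.dim_eq_card_independent[of "f ` ?I"] by linarith
    then obtain u w where u: "(\<Sum>x\<in>f ` ?I. u x *s x) = 0" "w \<in> f ` ?I" "u w \<noteq> 0"
      using vec.dependent_finite[of "f ` ?I"] by auto
    define p where "p = (\<Sum>i\<in>?I. monom (u (f i)) i)"
    obtain i where i: "i \<in> ?I" "w = f i" using u(2) by blast
    have "coeff p i = u (f i)" using i(1) by (simp add: p_def coeff_sum)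
    then have "p \<noteq> 0" using u(3) i(2) by auto
    have "mv.pev h (\<Sum>i\<in>A. monom (c i) i) v = (\<Sum>i\<in>A. c i *s f i)" if "finite A" for A c
      using that
      by (induction A) (simp_all add: mv.pev_add f_def mv.pev_smult[symmetric] smult_monom)
    then have "mv.pev h p v = (\<Sum>i\<in>?I. u (f i) *s f i)" by (simp add: p_def)
    also have "\<dots> = 0" using u(1) True by (simp add: sum.reindex)
    finally show ?thesis using \<open>p \<noteq> 0\<close> by blast
  qed
qed

text \<open>A product of polynomials, one killing each basis vector, kills the whole basis, and the
  kernel of p(h) is a subspace.\<close>

lemma annihilating_poly:
  fixes h :: "'a::field ^ 'n::finite ^ 'n"
  shows "\<exists>p. p \<noteq> 0 \<and> (\<forall>v. mv.pev h p v = 0)"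
proof -
  obtain P where P: "\<And>v. P v \<noteq> 0" "\<And>v. mv.pev h (P v) v = 0"
    using annihilating_poly_vector[of h] by metis
  define p where "p = (\<Prod>v\<in>(cart_basis :: ('a ^ 'n) set). P v)"
  have "p \<noteq> 0" by (simp add: p_def P(1) finite_cart_basis)
  moreover have "mv.pev h p v = 0" for v
  proof -
    have "vec.subspace {v. mv.pev h p v = 0}"
      by (rule vec.subspaceI) (auto simp: mv.pev_vadd mv.pev_vscale)
    moreover have "cart_basis \<subseteq> {v. mv.pev h p v = 0}"
    proof
      fix v :: "'a ^ 'n" assume "v \<in> cart_basis"
      then have "P v dvd p" unfolding p_def by (rule dvd_prodI[OF finite_cart_basis])
      then show "v \<in> {v. mv.pev h p v = 0}" using P(2)[of v] by (simp add: mv.pev_dvd)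
    qed
    ultimately have "vec.span cart_basis \<subseteq> {v. mv.pev h p v = 0}" by (rule vec.span_minimal[rotated])
    then show ?thesis by auto
  qed
  ultimately show ?thesis by blast
qed

lemma perfect_annihilating_separable_power:
  fixes h :: "'a::field ^ 'n::finite ^ 'n"
  assumes "perfect TYPE('a)"
  shows "\<exists>q k. separable_poly q \<and> (\<forall>v. mv.pev h (q ^ k) v = 0)"
proof -
  obtain p where p: "p \<noteq> 0" "\<And>v. mv.pev h p v = 0" using annihilating_poly by blast
  obtain q k where "separable_poly q" "p dvd q ^ k"
    using perfect_separable_radical[OF assms p(1)] by blast
  with p(2) show ?thesis by (metis mv.pev_dvd)
qed

text \<open>On an invariant complement of the kernel of q(s), the operator q(s) is injective and,
  since \<open>q ^ k\<close> kills everything, nilpotent. So the complement is 0 and the kernel is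
  the whole space.\<close>

lemma semisimple_imp_separable:
  fixes s :: "'a::field ^ 'n::finite ^ 'n"
  assumes "perfect TYPE('a)" and ss: "semisimple s"
  shows "\<exists>q. separable_poly q \<and> (\<forall>v. mv.pev s q v = 0)"
proof -
  obtain q k where q: "separable_poly q" "\<And>v. mv.pev s (q ^ k) v = 0"
    using perfect_annihilating_separable_power[OF assms(1)] by blast
  let ?W = "{v. mv.pev s q v = 0}"
  have "invariant_subspace s ?W"
    unfolding invariant_subspace_def
    by (auto intro!: vec.subspaceI simp: mv.pev_vadd mv.pev_vscale mv.pev_T)
  with ss have "\<exists>W'. invariant_subspace s W' \<and> ?W \<inter> W' = {0} \<and>
      {w + w' | w w'. w \<in> ?W \<and> w' \<in> W'} = UNIV"
    unfolding semisimple_def by (elim allE[of _ ?W] mp)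
  then obtain W' where W': "invariant_subspace s W'" "?W \<inter> W' = {0}"
      "{w + w' | w w'. w \<in> ?W \<and> w' \<in> W'} = UNIV"
    by (elim exE conjE)
  have 0: "w = 0" if "w \<in> W'" for w
  proof -
    have "mv.pev s (q ^ j) w = 0 \<Longrightarrow> w \<in> W' \<Longrightarrow> w = 0" for j w
    proof (induction j arbitrary: w)
      case (Suc j)
      have "mv.pev s (q ^ j) (mv.pev s q w) = 0" using Suc.prems(1) by (simp add: mv.pev_mult')
      then have "mv.pev s q w = 0"
        using Suc.IH invariant_subspace_pev[OF W'(1) Suc.prems(2)] by blast
      then show ?case using W'(2) Suc.prems(2) by blast
    qed simp
    then show ?thesis using q(2) that by blast
  qed
  have "mv.pev s q v = 0" for v
  proof -
    have "v \<in> {w + w' | w w'. w \<in> ?W \<and> w' \<in> W'}" unfolding W'(3) by (rule UNIV_I)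
    then obtain w w' where "v = w + w'" "w \<in> ?W" "w' \<in> W'" by blast
    then show ?thesis using 0[of w'] by (simp add: mv.pev_vadd)
  qed
  with q(1) show ?thesis by blast
qed

lemma invariant_subspace_sum:
  assumes "invariant_subspace g U" "invariant_subspace g W"
  shows "invariant_subspace g {u + w | u w. u \<in> U \<and> w \<in> W}"
  using assms unfolding invariant_subspace_def
  by (auto simp: vec.subspace_sums mv.T_add) blast

lemma invariant_subspace_cyclic:
  "invariant_subspace g (range (\<lambda>p. mv.pev g p v))"
  unfolding invariant_subspace_def
proof (intro conjI vec.subspaceI ballI)
  show "0 \<in> range (\<lambda>p. mv.pev g p v)" by (rule image_eqI[of _ _ 0]) simp_all
  show "x + y \<in> range (\<lambda>p. mv.pev g p v)"
    if "x \<in> range (\<lambda>p. mv.pev g p v)" "y \<in> range (\<lambda>p. mv.pev g p v)" for x y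
    using that by (auto simp: mv.pev_add[symmetric])
  show "c *s x \<in> range (\<lambda>p. mv.pev g p v)" if "x \<in> range (\<lambda>p. mv.pev g p v)" for c x
    using that by (auto simp: mv.pev_smult[symmetric])
  show "g *v x \<in> range (\<lambda>p. mv.pev g p v)" if "x \<in> range (\<lambda>p. mv.pev g p v)" for x
  proof -
    from that obtain p where "x = mv.pev g p v" by blast
    then have "g *v x = mv.pev g (pCons 0 p) v" by simp
    then show ?thesis by blast
  qed
qed

text \<open>A maximal invariant subspace meeting \<open>W\<close> trivially is a complement: otherwise some vector
  \<open>v\<close> outside the sum is killed by an irreducible factor of \<open>q\<close>, and its cyclic span can be added.\<close>

lemma separable_imp_semisimple:
  fixes s :: "'a::field ^ 'n::finite ^ 'n"
  assumes q: "separable_poly q" "\<And>v. mv.pev s q v = 0"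
  shows "semisimple s"
  unfolding semisimple_def
proof (intro allI impI)
  fix W assume W: "invariant_subspace s W"
  let ?P = "\<lambda>W'. invariant_subspace s W' \<and> W \<inter> W' = {0}"
  have "?P {0}" using W by (auto simp: invariant_subspace_def vec.subspace_0)
  moreover have "\<forall>W'. ?P W' \<longrightarrow> vec.dim W' < Suc (CARD('n))"
    using dim_subset_UNIV_cart_gen by (auto simp: less_Suc_eq_le)
  ultimately obtain W' where W': "?P W'" and max: "\<And>U. ?P U \<Longrightarrow> vec.dim U \<le> vec.dim W'"
    using ex_has_greatest_nat[of ?P "{0}" vec.dim "Suc (CARD('n))"] by blast
  define U where "U = {w + w' | w w'. w \<in> W \<and> w' \<in> W'}"
  have U: "invariant_subspace s U" unfolding U_def using W W' by (blast intro: invariant_subspace_sum)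
  then have subU: "vec.subspace U" by (simp add: invariant_subspace_def)
  have subs: "vec.subspace W" "vec.subspace W'" using W W' by (auto simp: invariant_subspace_def)
  have inU: "W \<subseteq> U" "W' \<subseteq> U"
    unfolding U_def using subs[THEN vec.subspace_0] by force+
  have "U = UNIV"
  proof (rule ccontr)
    assume "U \<noteq> UNIV"
    then obtain v where v: "v \<notin> U" by blast
    \<comment> \<open>Irreducible factors are peeled off \<open>g\<close>: if the cofactor takes
      \<open>v\<close> into \<open>U\<close>, it replaces \<open>g\<close>; otherwise its value at
      \<open>v\<close> is the vector sought.\<close>
    have "\<exists>p v. irreducible p \<and> p dvd g \<and> v \<notin> U \<and> mv.pev s p v \<in> U"
      if "v \<notin> U" "mv.pev s g v \<in> U" "g \<noteq> 0" for g v
      using that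
    proof (induction "degree g" arbitrary: g v rule: less_induct)
      case less
      show ?case
      proof (cases "degree g = 0")
        case True
        then obtain c where c: "g = [:c:]" by (metis degree_eq_zeroE)
        with less.prems have "c *s v \<in> U" "c \<noteq> 0" by auto
        then have "inverse c *s (c *s v) \<in> U" using vec.subspace_scale[OF subU] by blast
        with \<open>c \<noteq> 0\<close> less.prems(1) show ?thesis by simp
      next
        case False
        then obtain p g1 where p: "irreducible p" "g = p * g1"
          using field_poly_irreducible_factor by blast
        show ?thesis
        proof (cases "mv.pev s g1 v \<in> U")
          case True
          have nz: "p \<noteq> 0" "g1 \<noteq> 0" using p less.prems by auto
          have "degree p > 0"
            using p(1) nz by (auto simp: irreducible_def is_unit_iff_degree)
          then have "degree g1 < degree g" using nz p by (simp add: degree_mult_eq)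
          from less.hyps[OF this less.prems(1) True nz(2)] show ?thesis
            using p(2) by (meson dvd_trans dvd_triv_right)
        next
          case False
          then show ?thesis using p less.prems(2) by (auto simp: mv.pev_mult)
        qed
      qed
    qed
    moreover have "q \<noteq> 0" using q(1) by (auto simp: separable_poly_def)
    moreover have "mv.pev s q v \<in> U" using q(2) vec.subspace_0[OF subU] by simp
    ultimately obtain p v1 where p: "irreducible p" "p dvd q" "v1 \<notin> U" "mv.pev s p v1 \<in> U"
      using v by blast
    from p(2) obtain t where t: "q = p * t" by (rule dvdE)
    obtain a b where ab: "a * p + b * t = 1" using separable_poly_multD(2) q(1) t by blast
    \<comment> \<open>A projection to the kernel of p(s): it changes \<open>v1\<close> only by an
      element of \<open>U\<close>, and p t = q kills the result. Coprimality of \<open>p\<close> and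
      \<open>t\<close> comes from separability of \<open>q\<close>.\<close>
    define v2 where "v2 = mv.pev s (b * t) v1"
    have "v1 = mv.pev s (a * p) v1 + v2"
      by (simp only: v2_def mv.pev_add[symmetric] ab mv.pev_1)
    moreover have "mv.pev s (a * p) v1 \<in> U"
      using p(4) U by (simp add: mv.pev_mult invariant_subspace_pev)
    ultimately have v2: "v2 \<notin> U" using p(3) vec.subspace_add[OF subU] by metis
    have "mv.pev s p v2 = mv.pev s (b * q) v1"
      unfolding v2_def t by (simp only: mv.pev_mult[symmetric] mult_ac)
    then have pv2: "mv.pev s p v2 = 0" using q(2) by (simp add: mv.pev_mult)
    define W2 where "W2 = {w + w' | w w'. w \<in> W' \<and> w' \<in> range (\<lambda>p. mv.pev s p v2)}"
    have W2: "invariant_subspace s W2"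
      unfolding W2_def using W' invariant_subspace_cyclic by (blast intro: invariant_subspace_sum)
    have "W \<inter> W2 = {0}"
    proof -
      have "w = 0" if w: "w \<in> W" "w \<in> W2" for w
      proof -
        obtain w' g where wg: "w = w' + mv.pev s g v2" "w' \<in> W'" using w(2) unfolding W2_def by blast
        have "w - w' \<in> U" using w(1) wg(2) inU vec.subspace_diff[OF subU] by blast
        then have gU: "mv.pev s g v2 \<in> U" using wg(1) by simp
        \<comment> \<open>Otherwise \<open>p\<close> and \<open>g\<close> are coprime, and their
          Bezout identity applied to \<open>v2\<close> would place \<open>v2\<close> in
          \<open>U\<close>.\<close>
        have "p dvd g"
        proof (rule ccontr)
          assume "\<not> p dvd g"
          then obtain c d where cd: "c * p + d * g = 1"
            using coprime_field_poly_bezout irreducible_imp_coprime[OF p(1)] by blast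
          have "v2 = mv.pev s (c * p) v2 + mv.pev s (d * g) v2"
            by (simp only: mv.pev_add[symmetric] cd mv.pev_1)
          also have "\<dots> = mv.pev s d (mv.pev s g v2)" by (simp add: mv.pev_mult pv2)
          also have "\<dots> \<in> U" by (rule invariant_subspace_pev[OF U gU])
          finally show False using v2 by simp
        qed
        then have "mv.pev s g v2 = 0" using pv2 by (rule mv.pev_dvd)
        then show ?thesis using wg w W' by auto
      qed
      moreover have "0 \<in> W \<inter> W2" using subs W2 by (auto simp: invariant_subspace_def vec.subspace_0)
      ultimately show ?thesis by blast
    qed
    with W2 have "vec.dim W2 \<le> vec.dim W'" using max by blast
    moreover have "W' \<subset> W2"
    proof
      show "W' \<subseteq> W2"
      proof
        fix w assume "w \<in> W'"
        moreover have "w = w + mv.pev s 0 v2" by simp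
        ultimately show "w \<in> W2" unfolding W2_def by blast
      qed
      have "v2 = 0 + mv.pev s 1 v2" by simp
      then have "v2 \<in> W2" unfolding W2_def using vec.subspace_0[OF subs(2)] by blast
      then show "W' \<noteq> W2" using v2 inU by blast
    qed
    ultimately show False
      using vec.subspace_dim_equal[of W' W2] W2 subs by (auto simp: invariant_subspace_def)
  qed
  then show "\<exists>W'. invariant_subspace s W' \<and> W \<inter> W' = {0} \<and> {w + w' | w w'. w \<in> W \<and> w' \<in> W'} = UNIV"
    using W' unfolding U_def by blast
qed

section \<open>Jordan-Chevalley decomposition\<close>

lemma unipotent_iff:
  "unipotent u \<longleftrightarrow> (\<exists>k. \<forall>v. ((\<lambda>v. u *v v - v) ^^ k) v = 0)"
proof -
  have "(*v) (u - mat 1) = (\<lambda>v. u *v v - v)"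
    by (rule ext) (simp add: matrix_vector_mult_diff_rdistrib)
  then show ?thesis by (simp add: unipotent_def)
qed

text \<open>In the induction \<open>D\<close> is moved past N^k and then expanded as
  \<open>N\<close> after \<open>Y\<close>. Thus \<open>D\<close> is nilpotent as soon as
  \<open>N\<close> is, with the same exponent.\<close>

lemma funpow_left_factor:
  assumes "\<And>v. D v = N (Y v)" "\<And>v. D (N v) = N (D v)"
  shows "\<exists>w. (D ^^ k) v = (N ^^ k) w"
proof (induction k)
  case (Suc k)
  then obtain w where w: "(D ^^ k) v = (N ^^ k) w" by blast
  have "D ((N ^^ j) x) = (N ^^ j) (D x)" for j x
    by (induction j) (simp_all add: assms(2))
  then have "(D ^^ Suc k) v = (N ^^ k) (N (Y w))" using w assms(1) by simp
  then have "(D ^^ Suc k) v = (N ^^ Suc k) (Y w)" by (simp add: funpow_swap1)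
  then show ?case by blast
qed auto

lemma funpow_pev: "(mv.pev h p ^^ k) v = mv.pev h (p ^ k) v"
  by (induction k) (simp_all add: mv.pev_mult)

text \<open>Since s u - s = s (u - 1) and \<open>s\<close> commutes with u - 1, powers factor. This
  translates between unipotency of \<open>u\<close> and nilpotency of h - s, in both
  directions.\<close>

lemma nilpotent_part_power:
  fixes s u :: "'a::field ^ 'n::finite ^ 'n"
  assumes "s ** u = u ** s"
  shows "((\<lambda>v. (s ** u) *v v - s *v v) ^^ k) v = (((*v) s) ^^ k) (((\<lambda>v. u *v v - v) ^^ k) v)"
proof -
  define D where "D = (\<lambda>v. u *v v - v)"
  have 1: "(s ** u) *v v - s *v v = s *v D v" for v
    by (simp add: D_def mv.T_diff matrix_vector_mul_assoc)
  have "D (s *v v) = s *v D v" for v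
    by (simp add: D_def mv.T_diff matrix_vector_mul_assoc assms)
  then have 2: "D ((((*v) s) ^^ j) v) = (((*v) s) ^^ j) (D v)" for j v
    by (induction j) simp_all
  show ?thesis
    unfolding 1 D_def[symmetric] by (induction k) (simp_all add: 2)
qed

text \<open>Let q(s) = 0 with \<open>q\<close> separable, and let N = h - s, which is nilpotent.
  Then q(h) has a factor \<open>N\<close>, so q(h)^k = 0, and the Newton polynomial \<open>r\<close>
  makes r(h) a root of \<open>q\<close>. As r(s) = s, the difference r(h) - s also has a factor
  \<open>N\<close>, and uniqueness of roots forces r(h) = s.\<close>

theorem semisimple_part_polynomial:
  fixes h s u :: "'a::field ^ 'n::finite ^ 'n"
  assumes perf: "perfect TYPE('a)" and jc: "jordan_chevalley h s u"
  shows "\<exists>r. \<forall>v. s *v v = mv.pev h r v"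
proof -
  have su: "semisimple s" "unipotent u" "h = s ** u" "s ** u = u ** s"
    using jc by (auto simp: jordan_chevalley_def)
  obtain q where q: "separable_poly q" "\<And>v. mv.pev s q v = 0"
    using semisimple_imp_separable[OF perf su(1)] by blast
  obtain k where k: "\<And>v. ((\<lambda>v. u *v v - v) ^^ k) v = 0"
    using su(2) unfolding unipotent_iff by blast
  define N where "N = (\<lambda>v. h *v v - s *v v)"
  have "(((*v) s) ^^ k) 0 = 0" by (induction k) simp_all
  then have Nk: "(N ^^ k) v = 0" for v
    using nilpotent_part_power[OF su(4), of k v] by (simp add: N_def su(3) k)
  have comm: "h *v (s *v v) = s *v (h *v v)" for v
    by (simp add: matrix_vector_mul_assoc su(3) matrix_mul_assoc[symmetric] su(4)[symmetric])
  have N_add: "N (v + w) = N v + N w" for v w by (simp add: N_def mv.T_add)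
  have pN: "mv.pev h p (N v) = N (mv.pev h p v)" for p v
  proof -
    have "s *v mv.pev h p v = mv.pev h p (s *v v)"
      by (rule pev_commute[OF mv.lin_op_axioms mv.lin_op_axioms]) (simp add: comm)
    then show ?thesis by (simp add: N_def mv.pev_vdiff mv.pev_T)
  qed
  have taylor: "\<exists>Y. \<forall>v. mv.pev h p v = mv.pev s p v + N (Y v)" for p
  proof -
    obtain Z where "\<And>v. mv.pev h p v = mv.pev s p v + N (mv.pev s (pderiv p) v) + N (N (Z v))"
      using mv.pev_taylor[OF mv.lin_op_axioms[of h], of s p] comm by (auto simp: N_def Let_def)
    then have "mv.pev h p v = mv.pev s p v + N (mv.pev s (pderiv p) v + N (Z v))" for v
      by (simp add: N_add add.assoc)
    then show ?thesis by (intro exI[of _ "\<lambda>v. mv.pev s (pderiv p) v + N (Z v)"]) blast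
  qed
  have nil: "mv.pev h (q ^ k) v = 0" for v
  proof -
    obtain Y where "\<And>v. mv.pev h q v = N (Y v)" using taylor[of q] q(2) by auto
    from funpow_left_factor[of "mv.pev h q", OF this pN] Nk show ?thesis
      by (metis funpow_pev)
  qed
  obtain r where r: "q ^ k dvd pcompose q r" "q dvd r - [:0, 1:]"
    using separable_poly_newton[OF q(1)] by blast
  have rs: "mv.pev s r v = s *v v" for v
  proof -
    have "mv.pev s (r - [:0, 1:]) v = 0" using r(2) q(2) by (rule mv.pev_dvd)
    then show ?thesis by (simp add: mv.pev_diff)
  qed
  have "mv.pev h r v = s *v v" for v
  proof (rule mv.separable_root_unique[OF mv.lin_op_pev _ q(1)])
    show "mv.pev h r (s *v v) = s *v mv.pev h r v" for v
      by (rule pev_commute[OF mv.lin_op_axioms mv.lin_op_axioms, symmetric]) (simp add: comm)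
    show "mv.pev s q v = 0" for v by (rule q(2))
    show "lin_op.pev (*s) (mv.pev h r) q v = 0" for v
      unfolding mv.pev_pcompose[symmetric] using r(1) nil by (rule mv.pev_dvd)
    obtain Y where Y: "\<And>v. mv.pev h r v = s *v v + N (Y v)" using taylor[of r] rs by auto
    show "((\<lambda>v. mv.pev h r v - s *v v) ^^ k) v = 0" for v
    proof -
      have "\<exists>w. ((\<lambda>v. mv.pev h r v - s *v v) ^^ k) v = (N ^^ k) w"
      proof (rule funpow_left_factor)
        show "mv.pev h r v - s *v v = N (Y v)" for v using Y by simp
        show "mv.pev h r (N v) - s *v N v = N (mv.pev h r v - s *v v)" for v
          unfolding pN by (simp add: N_def mv.T_diff comm)
      qed
      then show ?thesis using Nk by auto
    qed
  qed
  then show ?thesis by metis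
qed

lemma
  fixes A :: "'a::semiring_1 ^ 'n ^ 'm"
  assumes "invertible A"
  shows matrix_inv_right: "A ** matrix_inv A = mat 1" and matrix_inv_left: "matrix_inv A ** A = mat 1"
  using someI_ex[OF assms[unfolded invertible_def]] by (simp_all add: matrix_inv_def)

lemma invertible_matrix_inv: "invertible A \<Longrightarrow> invertible (matrix_inv A)"
  unfolding invertible_def[of "matrix_inv A"] using matrix_inv_left matrix_inv_right by blast

text \<open>Newton iteration makes s = r(h) a root of \<open>q\<close>, hence semisimple, and h - s
  is nilpotent because \<open>q\<close> divides X - r. Existence matters because
  \<open>semisimple_parts\<close> collects only decompositions that exist, while the fixed vector
  argument needs one for every generator.\<close>

theorem jordan_chevalley_exists:
  fixes h :: "'a::field ^ 'n::finite ^ 'n"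
  assumes perf: "perfect TYPE('a)" and h: "invertible h"
  shows "\<exists>s u. jordan_chevalley h s u"
proof -
  obtain q k where q: "separable_poly q" "\<And>v. mv.pev h (q ^ k) v = 0"
    using perfect_annihilating_separable_power[OF perf] by blast
  obtain r where r: "q ^ k dvd pcompose q r" "q dvd r - [:0, 1:]"
    using separable_poly_newton[OF q(1)] by blast
  obtain s :: "'a ^ 'n ^ 'n" where s: "\<And>v. s *v v = mv.pev h r v" using matrix_eq_pev by blast
  then have s': "(*v) s = mv.pev h r" by blast
  have "mv.pev s q v = 0" for v
    unfolding s' mv.pev_pcompose[symmetric] using r(1) q(2) by (rule mv.pev_dvd)
  then have ss: "semisimple s" using q(1) by (rule separable_imp_semisimple[rotated])
  have inj_h: "inj ((*v) h)" using h by (simp add: invertible_left_inverse matrix_left_invertible_injective)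
  have dk: "mv.pev h (([:0, 1:] - r) ^ k) v = 0" for v
  proof -
    have "q dvd [:0, 1:] - r" using r(2) by (metis dvd_minus_iff minus_diff_eq)
    then show ?thesis using q(2) by (meson mv.pev_dvd dvd_power_same)
  qed
  have X: "mv.pev h [:0, 1:] = (*v) h" by (rule ext) simp
  have inj_s: "v = 0" if "s *v v = 0" for v
  proof -
    \<comment> \<open>On the kernel of \<open>s\<close> the operator \<open>h\<close> coincides with
      the nilpotent h - s. In polynomials: x - y divides x^k - y^k, with x = X and y = X -
      r.\<close>
    have "r dvd [:0, 1:] ^ k - ([:0, 1:] - r) ^ k"
    proof -
      have "[:0, 1:] - ([:0, 1:] - r) dvd [:0, 1:] ^ k - ([:0, 1:] - r) ^ k"
        by (simp add: power_diff_sumr2)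
      then show ?thesis by simp
    qed
    then have "mv.pev h ([:0, 1:] ^ k - ([:0, 1:] - r) ^ k) v = 0"
      using that unfolding s by (rule mv.pev_dvd)
    then have "mv.pev h ([:0, 1:] ^ k) v = 0" using dk by (simp add: mv.pev_diff)
    then have "(((*v) h) ^^ k) v = 0" 
      by (simp add: funpow_pev[symmetric] X)
    then show "v = 0"
    proof (induction k)
      case (Suc k)
      then have "h *v ((((*v) h) ^^ k) v) = h *v 0" by simp
      then show ?case using inj_h Suc.IH by (metis injD)
    qed simp
  qed
  then have inv_s: "invertible s"
    using matrix_left_invertible_ker[of s] by (simp add: invertible_left_inverse)
  define u where "u = matrix_inv s ** h"
  have su: "s ** u = h" using inv_s by (simp add: u_def matrix_mul_assoc matrix_inv_right)
  have "s ** h = h ** s"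
    unfolding matrix_eq by (simp add: matrix_vector_mul_assoc[symmetric] s mv.pev_T)
  then have us: "u ** s = h"
    using inv_s by (metis u_def matrix_inv_left matrix_mul_assoc matrix_mul_lid)
  have inv_u: "invertible u"
    unfolding u_def using invertible_matrix_inv[OF inv_s] h by (rule invertible_mult)
  have "((\<lambda>v. u *v v - v) ^^ k) v = 0" for v
  proof -
    have "(\<lambda>v. (s ** u) *v v - s *v v) = mv.pev h ([:0, 1:] - r)"
      by (rule ext) (simp add: su s mv.pev_diff)
    then have "((\<lambda>v. (s ** u) *v v - s *v v) ^^ k) v = 0"
      using dk by (simp add: funpow_pev)
    then have "(((*v) s) ^^ k) (((\<lambda>v. u *v v - v) ^^ k) v) = 0"
      using nilpotent_part_power[of s u k v] su us by simp
    moreover have "(((*v) s) ^^ j) w = 0 \<Longrightarrow> w = 0" for j w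
      by (induction j) (auto dest: inj_s)
    ultimately show ?thesis by blast
  qed
  then have "unipotent u" unfolding unipotent_iff by blast
  then have "jordan_chevalley h s u"
    using ss inv_s inv_u su us by (simp add: jordan_chevalley_def GL_def)
  then show ?thesis by blast
qed

lemma semisimple_part_commute:
  fixes h s u :: "'a::field ^ 'n::finite ^ 'n"
  assumes "perfect TYPE('a)" "jordan_chevalley h s u" "g ** h = h ** g"
  shows "g ** s = s ** g"
proof -
  obtain r where r: "\<And>v. s *v v = mv.pev h r v"
    using semisimple_part_polynomial[OF assms(1,2)] by blast
  have "g *v mv.pev h r v = mv.pev h r (g *v v)" for v
    by (rule pev_commute[OF mv.lin_op_axioms mv.lin_op_axioms])
       (simp add: matrix_vector_mul_assoc assms(3))
  then show ?thesis unfolding matrix_eq by (simp add: matrix_vector_mul_assoc[symmetric] r)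
qed

section \<open>Linear substitutions\<close>

lemma Const_0 [simp]: "Const 0 = 0"
  and Const_1 [simp]: "Const 1 = 1"
  and Const_add: "Const (a + b) = Const a + Const b"
  and Const_mult: "Const (a * b) = Const a * Const b"
  by (simp_all add: Const_def single_add mult_single)

lemma Var_power: "Var i ^ k = Poly_Mapping.single (Poly_Mapping.single i k) (1::'a::field)"
  by (induction k) (simp_all add: Var_def mult_single single_add[symmetric])

lemma prod_single_1:
  "(\<Prod>i\<in>A. Poly_Mapping.single (m i) (1::'a::field)) = Poly_Mapping.single (\<Sum>i\<in>A. m i) 1"
  by (induction A rule: infinite_finite_induct) (simp_all add: mult_single)

lemma sum_single_lookup:
  fixes m :: "'n::finite \<Rightarrow>\<^sub>0 nat"
  shows "(\<Sum>i\<in>UNIV. Poly_Mapping.single i (Poly_Mapping.lookup m i)) = m"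
  by (rule poly_mapping_eqI) (simp add: lookup_sum lookup_single when_def)

lemma single_eq_Const_prod_Var:
  fixes m :: "'n::finite \<Rightarrow>\<^sub>0 nat"
  shows "Poly_Mapping.single m a = Const a * (\<Prod>i\<in>UNIV. Var i ^ Poly_Mapping.lookup m i)"
  unfolding Var_power prod_single_1 sum_single_lookup by (simp add: Const_def mult_single)

lemma poly_mapping_sum_single:
  "(\<Sum>m\<in>Poly_Mapping.keys f. Poly_Mapping.single m (Poly_Mapping.lookup f m)) = f"
  by (rule poly_mapping_eqI) (simp add: lookup_sum lookup_single when_def in_keys_iff)

text \<open>Constants and variables generate the polynomials as a ring, so identities between
  homomorphisms are checked on generators, without monomials.\<close>

lemma mpoly_induct [case_names Const Var add mult]:
  fixes f :: "('a::field, 'n::finite) mpoly"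
  assumes C: "\<And>c. P (Const c)" and V: "\<And>i. P (Var i)"
    and A: "\<And>f g. P f \<Longrightarrow> P g \<Longrightarrow> P (f + g)" and M: "\<And>f g. P f \<Longrightarrow> P g \<Longrightarrow> P (f * g)"
  shows "P f"
proof -
  have 0: "P 0" and 1: "P 1" using C[of 0] C[of 1] by simp_all
  have pow: "P (Var i ^ k)" for i k by (induction k) (simp_all add: 1 V M)
  have "P (\<Prod>i\<in>B. Var i ^ m i)" for B and m :: "'n \<Rightarrow> nat"
    by (induction B rule: infinite_finite_induct) (simp_all add: 1 M pow)
  then have single: "P (Poly_Mapping.single m a)" for m a
    unfolding single_eq_Const_prod_Var by (intro M C)
  have "P (\<Sum>m\<in>B. Poly_Mapping.single m (Poly_Mapping.lookup f m))" for B
    by (induction B rule: infinite_finite_induct) (simp_all add: 0 A single)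
  then show ?thesis using poly_mapping_sum_single[of f] by metis
qed

text \<open>The target is an arbitrary commutative ring, so that linear substitution and extension
  of scalars become two instances of one evaluation.\<close>

locale field_ring_hom =
  fixes c :: "'a::field \<Rightarrow> 'r::comm_ring_1"
  assumes c_1 [simp]: "c 1 = 1" and c_add: "c (a + b) = c a + c b" and c_mult: "c (a * b) = c a * c b"
begin

lemma c_0 [simp]: "c 0 = 0"
  using c_add[of 0 0] by simp

definition evalm :: "('n \<Rightarrow> 'r) \<Rightarrow> ('a, 'n::finite) mpoly \<Rightarrow> 'r" where
  "evalm \<sigma> f = (\<Sum>m \<in> Poly_Mapping.keys f.
     c (Poly_Mapping.lookup f m) * (\<Prod>i\<in>UNIV. \<sigma> i ^ Poly_Mapping.lookup m i))"

lemma evalm_single: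
  "evalm \<sigma> (Poly_Mapping.single m a) = c a * (\<Prod>i\<in>UNIV. \<sigma> i ^ Poly_Mapping.lookup m i)"
  by (cases "a = 0") (simp_all add: evalm_def)

lemma evalm_add: "evalm \<sigma> (f + g) = evalm \<sigma> f + evalm \<sigma> g"
  unfolding evalm_def
  by (rule setsum_keys_plus_distrib) (simp_all add: c_add distrib_right)

lemma evalm_0 [simp]: "evalm \<sigma> 0 = 0"
  by (simp add: evalm_def)

lemma evalm_sum: "evalm \<sigma> (\<Sum>x\<in>A. f x) = (\<Sum>x\<in>A. evalm \<sigma> (f x))"
  by (induction A rule: infinite_finite_induct) (simp_all add: evalm_add)

lemma evalm_Const [simp]: "evalm \<sigma> (Const a) = c a"
  by (simp add: Const_def evalm_single)

lemma evalm_Var [simp]: "evalm \<sigma> (Var i) = \<sigma> i"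
proof -
  have "(\<Prod>j\<in>UNIV. \<sigma> j ^ Poly_Mapping.lookup (Poly_Mapping.single i 1) j) = (\<Prod>j\<in>UNIV. if j = i then \<sigma> j else 1)"
    by (rule prod.cong) (auto simp: lookup_single when_def)
  then show ?thesis by (simp add: Var_def evalm_single)
qed

lemma evalm_mult: "evalm \<sigma> (f * g) = evalm \<sigma> f * evalm \<sigma> g"
proof -
  have 1: "evalm \<sigma> (Poly_Mapping.single m a * Poly_Mapping.single n b)
      = evalm \<sigma> (Poly_Mapping.single m a) * evalm \<sigma> (Poly_Mapping.single n b)" for m n a b
    by (simp add: mult_single evalm_single c_mult lookup_add power_add prod.distrib mult_ac)
  let ?S = "\<lambda>f. \<Sum>m\<in>Poly_Mapping.keys f. Poly_Mapping.single m (Poly_Mapping.lookup f m)"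
  have "evalm \<sigma> (?S f * ?S g) = evalm \<sigma> (?S f) * evalm \<sigma> (?S g)"
    unfolding sum_product evalm_sum 1 ..
  then show ?thesis unfolding poly_mapping_sum_single .
qed

end

interpretation Const: field_ring_hom Const
  by unfold_locales (simp_all add: Const_add Const_mult)

interpretation mp: vector_space "\<lambda>c (f :: ('a::field, 'n::finite) mpoly). Const c * f"
  by unfold_locales (simp_all add: Const_add Const_mult algebra_simps)

section \<open>Substitution of linear forms\<close>

definition linear_form :: "'a::field ^ 'n \<Rightarrow> ('a, 'n::finite) mpoly" where
  "linear_form r = (\<Sum>j\<in>UNIV. Const (r $ j) * Var j)"

text \<open>The pullback f(A v), without the inverse that \<open>act\<close> applies. For invertible
  \<open>g\<close> the polynomials fixed by \<open>lin g\<close> and by \<open>act g\<close> are the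
  same.\<close>

definition lin :: "'a::field ^ 'n ^ 'n \<Rightarrow> ('a, 'n::finite) mpoly \<Rightarrow> ('a, 'n) mpoly" where
  "lin A = subst (\<lambda>i. linear_form (A $ i))"

lemma lin_eq_evalm: "lin A = Const.evalm (\<lambda>i. linear_form (A $ i))"
  by (rule ext) (simp add: lin_def subst_def Const.evalm_def)

lemma act_eq_lin: "act g = lin (matrix_inv g)"
  by (simp add: act_def lin_def linear_form_def)

lemma lin_add: "lin A (f + g) = lin A f + lin A g"
  and lin_mult: "lin A (f * g) = lin A f * lin A g"
  and lin_Const [simp]: "lin A (Const a) = Const a"
  and lin_Var [simp]: "lin A (Var i) = linear_form (A $ i)"
  and lin_0 [simp]: "lin A 0 = 0"
  and lin_sum: "lin A (\<Sum>x\<in>S. F x) = (\<Sum>x\<in>S. lin A (F x))"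
  by (simp_all add: lin_eq_evalm Const.evalm_add Const.evalm_mult Const.evalm_sum)

interpretation lo: lin_op "\<lambda>c (f :: ('a::field, 'n::finite) mpoly). Const c * f" "lin A"
  for A :: "'a::field ^ 'n::finite ^ 'n"
  by unfold_locales (simp_all add: lin_add lin_mult)

interpretation rv: lin_op "(*s)" "\<lambda>r. r v* A" for A :: "'a::field ^ 'n::finite ^ 'n"
  by unfold_locales
     (simp_all add: vector_matrix_mult_def vec_eq_iff algebra_simps sum.distrib sum_distrib_left)

lemma linear_form_add: "linear_form (r + r') = linear_form r + linear_form r'"
  by (simp add: linear_form_def Const_add distrib_right sum.distrib)

lemma linear_form_scale: "linear_form (c *s r) = Const c * linear_form r"
  by (simp only: linear_form_def vector_smult_component Const_mult mult.assoc sum_distrib_left)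

lemma linear_form_0: "linear_form 0 = 0"
  by (simp add: linear_form_def)

lemma Var_eq_linear_form:
  fixes i :: "'n::finite"
  shows "(Var i :: ('a::field, 'n) mpoly) = linear_form (axis i 1)"
proof -
  have "linear_form (axis i 1) = (\<Sum>j\<in>UNIV. if j = i then Var j else (0 :: ('a, 'n) mpoly))"
    unfolding linear_form_def by (rule sum.cong) (auto simp: axis_def)
  then show ?thesis by simp
qed

lemma Const_sum: "Const (\<Sum>x\<in>S. f x) = (\<Sum>x\<in>S. Const (f x))"
  by (induction S rule: infinite_finite_induct) (simp_all add: Const_add)

lemma lin_linear_form: "lin A (linear_form r) = linear_form (r v* A)"
proof -
  have "lin A (linear_form r) = (\<Sum>i\<in>UNIV. \<Sum>j\<in>UNIV. Const (r $ i * A $ i $ j) * Var j)"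
    by (simp only: linear_form_def[of r] lin_sum lin_mult lin_Const lin_Var)
       (simp only: linear_form_def Const_mult mult.assoc sum_distrib_left)
  also have "\<dots> = (\<Sum>j\<in>UNIV. \<Sum>i\<in>UNIV. Const (r $ i * A $ i $ j) * Var j)" by (rule sum.swap)
  also have "\<dots> = linear_form (r v* A)"
    by (simp add: linear_form_def vector_matrix_mult_def Const_sum sum_distrib_left mult.commute)
  finally show ?thesis .
qed

lemma row_vector_matrix_mult: "(A ** B) $ i = A $ i v* B"
  by (simp add: matrix_matrix_mult_def vector_matrix_mult_def vec_eq_iff mult.commute)

lemma lin_matrix_mult: "lin (A ** B) f = lin B (lin A f)"
  by (induction f rule: mpoly_induct)
     (simp_all add: lin_add lin_mult lin_linear_form row_vector_matrix_mult)

lemma lin_mat_1 [simp]: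
  fixes f :: "('a::field, 'n::finite) mpoly"
  shows "lin (mat 1) f = f"
proof (induction f rule: mpoly_induct)
  case (Var i)
  have "(mat 1 :: 'a ^ 'n ^ 'n) $ i = axis i 1" by (auto simp: mat_def axis_def vec_eq_iff)
  then show ?case by (simp add: Var_eq_linear_form[symmetric])
qed (simp_all add: lin_add lin_mult)

text \<open>The row action is adjoint to the column action under the dot product, which is
  nondegenerate: pairing with unit vectors reads off coordinates.\<close>

lemma pev_row_eq_0:
  fixes A :: "'a::field ^ 'n::finite ^ 'n"
  assumes "\<And>v. mv.pev A p v = 0"
  shows "rv.pev A p r = 0"
proof -
  define B where "B r v = (\<Sum>i\<in>UNIV. r $ i * v $ i)" for r v :: "'a ^ 'n"
  have "B (rv.pev A p r) v = B r (mv.pev A p v)" for v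
  proof (rule pev_adjoint[OF rv.lin_op_axioms mv.lin_op_axioms])
    show "B (r v* A) v = B r (A *v v)" for r v
    proof -
      have "B (r v* A) v = (\<Sum>j\<in>UNIV. \<Sum>i\<in>UNIV. r $ i * A $ i $ j * v $ j)"
        by (simp add: B_def vector_matrix_mult_def sum_distrib_left mult.commute mult.left_commute)
      also have "\<dots> = (\<Sum>i\<in>UNIV. \<Sum>j\<in>UNIV. r $ i * A $ i $ j * v $ j)" by (rule sum.swap)
      also have "\<dots> = B r (A *v v)"
        by (simp add: B_def matrix_vector_mult_def sum_distrib_left mult.assoc)
      finally show ?thesis .
    qed
  qed (simp_all add: B_def algebra_simps sum.distrib sum_distrib_left)
  then have 0: "B (rv.pev A p r) v = 0" for v using assms by (simp add: B_def)
  have "rv.pev A p r $ j = 0" for j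
  proof -
    have "B w (axis j 1) = (\<Sum>i\<in>UNIV. if i = j then w $ i else 0)" for w
      unfolding B_def by (rule sum.cong) (auto simp: axis_def)
    then show ?thesis using 0[of "axis j 1"] by simp
  qed
  then show ?thesis by (simp add: vec_eq_iff)
qed

text \<open>Variables are the linear forms of unit rows, and \<open>linear_form\<close> intertwines
  the row action with \<open>lin A\<close>. The same \<open>p\<close> need not kill products of
  variables, so nilpotency and diagonalizability are extended to products separately.\<close>

lemma pev_lin_Var_eq_0:
  fixes A :: "'a::field ^ 'n::finite ^ 'n"
  assumes "\<And>v. mv.pev A p v = 0"
  shows "lo.pev A p (Var i) = 0"
proof -
  have "linear_form (rv.pev A p r) = lo.pev A (map_poly (\<lambda>x. x) p) (linear_form r)" for r
    by (rule pev_intertwine[OF rv.lin_op_axioms lo.lin_op_axioms])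
       (simp_all add: linear_form_add linear_form_scale lin_linear_form)
  then have eq: "linear_form (rv.pev A p r) = lo.pev A p (linear_form r)" for r by simp
  have "lo.pev A p (linear_form r) = 0" for r
    unfolding eq[symmetric] pev_row_eq_0[OF assms] by (rule linear_form_0)
  then show ?thesis by (simp add: Var_eq_linear_form)
qed

section \<open>Invariants of semisimple parts\<close>

text \<open>For d = lin A - 1 one has d(f g) = df dg + df g + f dg, and each term on the right has
  exponents of smaller sum.\<close>

lemma pev_X_minus_1_power_mult:
  fixes f g :: "('a::field, 'n::finite) mpoly"
  assumes "lo.pev A ([:- 1, 1:] ^ a) f = 0" "lo.pev A ([:- 1, 1:] ^ b) g = 0"
  shows "lo.pev A ([:- 1, 1:] ^ (a + b)) (f * g) = 0"
  using assms
proof (induction "a + b" arbitrary: a b f g)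
  case 0
  then show ?case by simp
next
  case (Suc n)
  let ?d = "lo.pev A [:- 1, 1:]"
  have pow: "lo.pev A ([:- 1, 1:] ^ Suc k) x = lo.pev A ([:- 1, 1:] ^ k) (?d x)" for k x
    by (simp only: power_Suc2 lo.pev_mult)
  have d: "?d x = lin A x - x" for x by (simp add: lo.pev_linear)
  show ?case
  proof (cases "a = 0 \<or> b = 0")
    case True
    then have "f * g = 0" using Suc.prems by auto
    then show ?thesis by simp
  next
    case False
    then obtain a' b' where ab: "a = Suc a'" "b = Suc b'" by (meson not0_implies_Suc)
    have n: "n = a' + b" "n = a + b'" using Suc.hyps(2) ab by simp_all
    have df: "lo.pev A ([:- 1, 1:] ^ a') (?d f) = 0" and dg: "lo.pev A ([:- 1, 1:] ^ b') (?d g) = 0"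
      using Suc.prems unfolding ab pow .
    \<comment> \<open>The exponent \<open>b'\<close> already kills \<open>?d g\<close>; the weaker
      \<open>b\<close> is recorded so that its sum with \<open>a'\<close> is exactly
      \<open>n\<close>.\<close>
    have "lo.pev A ([:- 1, 1:] ^ b) (?d g) = 0" unfolding ab(2)
      by (simp only: power_Suc lo.pev_mult dg lo.pev_v0)
    then have 1: "lo.pev A ([:- 1, 1:] ^ n) (?d f * ?d g) = 0"
      using Suc.hyps(1)[OF n(1) df] n(1) by simp
    have 2: "lo.pev A ([:- 1, 1:] ^ n) (?d f * g) = 0"
      using Suc.hyps(1)[OF n(1) df Suc.prems(2)] n(1) by simp
    have 3: "lo.pev A ([:- 1, 1:] ^ n) (f * ?d g) = 0"
      using Suc.hyps(1)[OF n(2) Suc.prems(1) dg] n(2) by simp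
    have "?d (f * g) = ?d f * ?d g + ?d f * g + f * ?d g"
      unfolding d lin_mult by (simp add: algebra_simps)
    then have "lo.pev A ([:- 1, 1:] ^ Suc n) (f * g) = 0"
      unfolding pow by (simp only: lo.pev_vadd 1 2 3 add_0)
    then show ?thesis using Suc.hyps(2) by simp
  qed
qed

text \<open>The exponent depends on \<open>f\<close>: on variables it comes from unipotency of
  \<open>u\<close>, and for sums and products the exponents are added.\<close>

lemma unipotent_lin_nilpotent:
  fixes f :: "('a::field, 'n::finite) mpoly"
  assumes "unipotent u"
  shows "\<exists>k. lo.pev u ([:- 1, 1:] ^ k) f = 0"
proof (induction f rule: mpoly_induct)
  case (Const c)
  have "lo.pev u ([:- 1, 1:] ^ 1) (Const c) = 0" by simp
  then show ?case by blast
next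
  case (Var i)
  obtain k where "\<And>v. ((\<lambda>v. u *v v - v) ^^ k) v = 0" using assms unfolding unipotent_iff by blast
  then have "mv.pev u ([:- 1, 1:] ^ k) v = 0" for v
    by (simp add: mv.pev_linear_power)
  then have "lo.pev u ([:- 1, 1:] ^ k) (Var i) = 0" by (rule pev_lin_Var_eq_0)
  then show ?case by blast
next
  case (add f g)
  then obtain a b where ab: "lo.pev u ([:- 1, 1:] ^ a) f = 0" "lo.pev u ([:- 1, 1:] ^ b) g = 0"
    by blast
  have "[:- 1, 1:] ^ a dvd [:- 1, 1 :: 'a:] ^ (a + b)" "[:- 1, 1:] ^ b dvd [:- 1, 1 :: 'a:] ^ (a + b)"
    by (simp_all add: le_imp_power_dvd)
  then have "lo.pev u ([:- 1, 1:] ^ (a + b)) (f + g) = 0"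
    using ab by (simp only: lo.pev_vadd lo.pev_dvd add_0)
  then show ?case by blast
next
  case (mult f g)
  then show ?case using pev_X_minus_1_power_mult by blast
qed

text \<open>Eigenvalues multiply because \<open>lin A\<close> is a ring homomorphism. Bilinearity
  extends this to spans, one factor at a time through \<open>sub\<close>.\<close>

lemma span_eigenvectors_mult:
  fixes f g :: "('a::field, 'n::finite) mpoly"
  assumes "f \<in> mp.span (lo.eigenvectors A)" "g \<in> mp.span (lo.eigenvectors A)"
  shows "f * g \<in> mp.span (lo.eigenvectors A)"
proof -
  let ?S = "mp.span (lo.eigenvectors A)"
  have 1: "e * e' \<in> ?S" if "e \<in> lo.eigenvectors A" "e' \<in> lo.eigenvectors A" for e e'
  proof -
    from that obtain c c' where "lin A e = Const c * e" "lin A e' = Const c' * e'"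
      by (auto simp: lo.eigenvectors_def)
    then have "lin A (e * e') = Const (c * c') * (e * e')"
      unfolding lin_mult Const_mult by (simp only: mult_ac)
    then have "e * e' \<in> lo.eigenvectors A" unfolding lo.eigenvectors_def by blast
    then show ?thesis by (rule mp.span_base)
  qed
  have sub: "mp.subspace {x. y * x \<in> ?S}" for y
  proof (rule mp.subspaceI, safe)
    show "y * 0 \<in> ?S" by (simp add: mp.span_zero)
    show "y * (x + x') \<in> ?S" if "y * x \<in> ?S" "y * x' \<in> ?S" for x x'
      using mp.span_add[OF that] by (simp add: distrib_left)
    show "y * (Const c * x) \<in> ?S" if "y * x \<in> ?S" for c x
      using mp.span_scale[OF that, of c] by (simp only: mult.left_commute)
  qed
  have 2: "e * g \<in> ?S" if "e \<in> lo.eigenvectors A" for e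
    using mp.span_minimal[OF _ sub[of e], of "lo.eigenvectors A"] 1[OF that] assms(2) by blast
  have "?S \<subseteq> {x. g * x \<in> ?S}"
    by (rule mp.span_minimal[OF _ sub]) (use 2 in \<open>auto simp: mult.commute\<close>)
  then show ?thesis using assms(1) by (auto simp: mult.commute)
qed

lemma span_eigenvectors_lin_eq_UNIV:
  fixes f :: "('a::alg_closed_field, 'n::finite) mpoly"
  assumes "separable_poly q" "\<And>i. lo.pev A q (Var i :: ('a, 'n) mpoly) = 0"
  shows "f \<in> mp.span (lo.eigenvectors A)"
proof (induction f rule: mpoly_induct)
  case (Const c)
  have "lin A (Const c) = Const 1 * Const c" by simp
  then have "Const c \<in> lo.eigenvectors A" unfolding lo.eigenvectors_def by blast
  then show ?case by (rule mp.span_base)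
next
  case (Var i)
  show ?case
    by (rule lo.separable_eigenvector_decomposition[OF _ assms(1) assms(2)])
       (rule alg_closed_imp_poly_has_root)
qed (auto intro: mp.span_add span_eigenvectors_mult)

section \<open>Extension of scalars to the algebraic closure\<close>

interpretation ac: field_ring_hom "\<lambda>c. Const (to_ac c) :: ('a::field alg_closure, 'n::finite) mpoly"
  by unfold_locales (simp_all add: Const_add Const_mult)

definition base_change :: "('a::field, 'n::finite) mpoly \<Rightarrow> ('a alg_closure, 'n) mpoly" where
  "base_change = ac.evalm Var"

definition base_change_matrix :: "'a::field ^ 'n ^ 'n \<Rightarrow> 'a alg_closure ^ 'n ^ 'n" where
  "base_change_matrix A = (\<chi> i j. to_ac (A $ i $ j))"

lemma base_change_Const [simp]: "base_change (Const c) = Const (to_ac c)"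
  and base_change_Var [simp]: "base_change (Var i) = Var i"
  and base_change_add: "base_change (f + g) = base_change f + base_change g"
  and base_change_mult: "base_change (f * g) = base_change f * base_change g"
  and base_change_0 [simp]: "base_change 0 = 0"
  and base_change_sum: "base_change (\<Sum>x\<in>S. F x) = (\<Sum>x\<in>S. base_change (F x))"
  by (simp_all add: base_change_def ac.evalm_add ac.evalm_mult ac.evalm_sum)

text \<open>Its purpose is injectivity of \<open>base_change\<close>, by which an equation over the
  closure descends to the ground field.\<close>

lemma lookup_base_change: "Poly_Mapping.lookup (base_change f) m = to_ac (Poly_Mapping.lookup f m)"
proof -
  have "base_change f = (\<Sum>m\<in>Poly_Mapping.keys f. Poly_Mapping.single m (to_ac (Poly_Mapping.lookup f m)))"
    by (simp add: base_change_def ac.evalm_def single_eq_Const_prod_Var)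
  then show ?thesis by (simp add: lookup_sum lookup_single when_def in_keys_iff)
qed

lemma base_change_eq_iff: "base_change f = base_change g \<longleftrightarrow> f = g"
  by (simp add: poly_mapping_eq_iff fun_eq_iff lookup_base_change)

lemma base_change_lin: "base_change (lin A f) = lin (base_change_matrix A) (base_change f)"
  by (induction f rule: mpoly_induct)
     (simp_all add: lin_add lin_mult base_change_add base_change_mult linear_form_def base_change_sum base_change_matrix_def)

lemma base_change_pev: "base_change (lo.pev A p f) = lo.pev (base_change_matrix A) (map_poly to_ac p) (base_change f)"
  by (rule pev_intertwine[OF lo.lin_op_axioms lo.lin_op_axioms])
     (simp_all add: base_change_add base_change_mult base_change_lin)

lemma map_poly_to_ac_add: "map_poly to_ac (p + q) = map_poly to_ac p + map_poly to_ac q"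
  by (rule poly_eqI) (simp add: coeff_map_poly)

lemma map_poly_to_ac_mult: "map_poly to_ac (p * q) = map_poly to_ac p * map_poly to_ac q"
  by (rule poly_eqI) (simp add: coeff_map_poly coeff_mult to_ac_sum)

lemma map_poly_to_ac_pderiv: "map_poly to_ac (pderiv p) = pderiv (map_poly to_ac p)"
  by (rule poly_eqI) (simp add: coeff_map_poly coeff_pderiv)

lemma separable_poly_map_to_ac:
  assumes "separable_poly q"
  shows "separable_poly (map_poly to_ac q)"
proof -
  obtain a b where "a * q + b * pderiv q = 1" using assms by (auto simp: separable_poly_def)
  then have "map_poly to_ac (a * q + b * pderiv q) = 1" by simp
  then show ?thesis
    unfolding separable_poly_def map_poly_to_ac_add map_poly_to_ac_mult map_poly_to_ac_pderiv by blast
qed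

text \<open>With d = lin s - 1 and e = lin u - 1, invariance of \<open>f\<close> reads lin u (d f) =
  - e f, so (lin u)^k d^k f equals e^k f up to sign. The right side vanishes for some
  \<open>k\<close>, and injectivity of \<open>lin u\<close> leaves d^k f = 0: a generalized
  eigenvector of \<open>s\<close> for the eigenvalue 1.\<close>

lemma invariant_under_semisimple_part:
  fixes f :: "('a::field, 'n::finite) mpoly"
  assumes perf: "perfect TYPE('a)" and jc: "jordan_chevalley h s u" and f: "lin h f = f"
  shows "lin s f = f"
proof -
  have su: "semisimple s" "unipotent u" "h = s ** u" "h = u ** s"
    using jc by (auto simp: jordan_chevalley_def)
  have inv_u: "invertible u" using jc by (simp add: jordan_chevalley_def GL_def)
  obtain k where k: "lo.pev u ([:- 1, 1:] ^ k) f = 0" using unipotent_lin_nilpotent[OF su(2)] by blast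
  let ?d = "lo.pev s [:- 1, 1:]" and ?e = "lo.pev u [:- 1, 1:]"
  have comm: "lin u (lin s g) = lin s (lin u g)" for g
    using su(3,4) by (metis lin_matrix_mult)
  have inj_u: "g = 0" if "lin u g = 0" for g
  proof -
    have "lin (matrix_inv u) (lin u g) = g"
      by (simp add: lin_matrix_mult[symmetric] matrix_inv_right[OF inv_u])
    then show ?thesis using that by simp
  qed
  have base: "lin u (?d f) = - ?e f"
    using f by (simp add: lo.pev_linear lo.T_diff comm) (simp add: su(4) lin_matrix_mult)
  have swap: "lin u (lo.pev s p g) = lo.pev s p (lin u g)" for p g
    by (rule pev_commute[OF lo.lin_op_axioms lo.lin_op_axioms]) (rule comm)
  have swap': "lo.pev s p (lo.pev u p' g) = lo.pev u p' (lo.pev s p g)" for p p' g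
    by (rule pev_commute[OF lo.lin_op_axioms lo.lin_op_pev]) (rule swap[symmetric])
  have iter: "(lin u ^^ j) (lo.pev s ([:- 1, 1:] ^ j) f) = (if even j then 1 else - 1) * lo.pev u ([:- 1, 1:] ^ j) f" for j
  proof (induction j)
    case (Suc j)
    have uj: "(lin u ^^ j) (lo.pev s p g) = lo.pev s p ((lin u ^^ j) g)" for p g
      by (induction j) (simp_all add: swap)
    have "(lin u ^^ Suc j) (lo.pev s ([:- 1, 1:] ^ Suc j) f)
        = lin u (?d ((lin u ^^ j) (lo.pev s ([:- 1, 1:] ^ j) f)))"
      by (simp only: power_Suc lo.pev_mult funpow.simps o_apply uj)
    also have "\<dots> = (if even j then 1 else - 1) * lin u (?d (lo.pev u ([:- 1, 1:] ^ j) f))"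
      unfolding Suc.IH
      by (simp add: lo.T_minus lo.T_diff)
    also have "lin u (?d (lo.pev u ([:- 1, 1:] ^ j) f)) = lo.pev u ([:- 1, 1:] ^ j) (lin u (?d f))"
      unfolding swap' lo.pev_T ..
    also have "\<dots> = - lo.pev u ([:- 1, 1:] ^ Suc j) f"
      unfolding base by (simp only: power_Suc2 lo.pev_mult lin_op.T_minus[OF lo.lin_op_pev])
    finally show ?case by simp
  qed simp
  have "(lin u ^^ j) g = 0 \<Longrightarrow> g = 0" for j g
    by (induction j) (auto dest: inj_u)
  then have "lo.pev s ([:- 1, 1:] ^ k) f = 0" using iter[of k] k by simp
  then have "lo.pev (base_change_matrix s) (map_poly to_ac ([:- 1, 1:] ^ k)) (base_change f) = 0"
    using base_change_pev by (metis base_change_0)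
  moreover have "map_poly to_ac ([:- 1, 1 :: 'a:] ^ k) = [:- 1, 1:] ^ k"
    by (induction k) (simp_all only: power_Suc map_poly_to_ac_mult, simp_all add: map_poly_pCons)
  ultimately have nil: "lo.pev (base_change_matrix s) ([:- 1, 1:] ^ k) (base_change f) = 0" by simp
  obtain q where q: "separable_poly q" "\<And>v. mv.pev s q v = 0"
    using semisimple_imp_separable[OF perf su(1)] by blast
  have "lo.pev (base_change_matrix s) (map_poly to_ac q) (Var i) = 0" for i
    using base_change_pev[of s q "Var i"] pev_lin_Var_eq_0[OF q(2)] by simp
  then have "base_change f \<in> mp.span (lo.eigenvectors (base_change_matrix s))"
    by (rule span_eigenvectors_lin_eq_UNIV[OF separable_poly_map_to_ac[OF q(1)]])
  then have "lin (base_change_matrix s) (base_change f) = Const 1 * base_change f"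
    using nil by (rule lo.span_eigenvectors_generalized_eigenvector)
  then show ?thesis by (simp add: base_change_lin[symmetric] base_change_eq_iff)
qed

section \<open>Homogeneous components and fixed vectors\<close>

abbreviation total_degree :: "('n::finite \<Rightarrow>\<^sub>0 nat) \<Rightarrow> nat" where
  "total_degree m \<equiv> (\<Sum>i\<in>UNIV. Poly_Mapping.lookup m i)"

lemma homogeneous_0 [simp]: "homogeneous d 0"
  by (simp add: homogeneous_def)

lemma homogeneous_add: "homogeneous d f \<Longrightarrow> homogeneous d g \<Longrightarrow> homogeneous d (f + g)"
  using keys_add[of f g] by (auto simp: homogeneous_def)

lemma homogeneous_sum: "(\<And>x. x \<in> S \<Longrightarrow> homogeneous d (F x)) \<Longrightarrow> homogeneous d (\<Sum>x\<in>S. F x)"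
  by (induction S rule: infinite_finite_induct) (simp_all add: homogeneous_add)

lemma homogeneous_mult: "homogeneous d f \<Longrightarrow> homogeneous e g \<Longrightarrow> homogeneous (d + e) (f * g)"
  using keys_mult[of f g] by (fastforce simp: homogeneous_def lookup_add sum.distrib)

lemma homogeneous_Const [simp]: "homogeneous 0 (Const c)"
  by (simp add: homogeneous_def Const_def)

lemma homogeneous_Var [simp]: "homogeneous 1 (Var i)"
proof -
  have "(\<Sum>j\<in>UNIV. Poly_Mapping.lookup (Poly_Mapping.single i 1) j) = (\<Sum>j\<in>UNIV. if j = i then 1 else (0 :: nat))"
    by (rule sum.cong) (auto simp: lookup_single when_def)
  then show ?thesis by (simp add: homogeneous_def Var_def)
qed

lemma homogeneous_Const_mult: "homogeneous d f \<Longrightarrow> homogeneous d (Const c * f)"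
  using homogeneous_mult[OF homogeneous_Const, of d f c] by simp

lemma homogeneous_linear_form: "homogeneous 1 (linear_form r)"
  unfolding linear_form_def by (intro homogeneous_sum homogeneous_Const_mult homogeneous_Var)

lemma homogeneous_power: "homogeneous d f \<Longrightarrow> homogeneous (k * d) (f ^ k)"
proof (induction k)
  case 0
  then show ?case using homogeneous_Const[of 1] by simp
qed (simp add: homogeneous_mult)

lemma homogeneous_prod:
  "(\<And>x. x \<in> S \<Longrightarrow> homogeneous (d x) (F x)) \<Longrightarrow> homogeneous (\<Sum>x\<in>S. d x) (\<Prod>x\<in>S. F x)"
proof (induction S rule: infinite_finite_induct)
  case (insert x S)
  then show ?case by (simp add: homogeneous_mult)
qed (use homogeneous_Const[of 1] in simp_all)

lemma homogeneous_lin: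
  assumes "homogeneous d f"
  shows "homogeneous d (lin A f)"
  unfolding lin_eq_evalm Const.evalm_def
proof (intro homogeneous_sum homogeneous_Const_mult)
  fix m assume "m \<in> Poly_Mapping.keys f"
  then have "d = (\<Sum>i\<in>UNIV. Poly_Mapping.lookup m i * 1)" using assms by (simp add: homogeneous_def)
  then show "homogeneous d (\<Prod>i\<in>UNIV. linear_form (A $ i) ^ Poly_Mapping.lookup m i)"
    by (simp only:) (intro homogeneous_prod homogeneous_power homogeneous_linear_form)
qed

section \<open>Homogeneous components\<close>

definition component :: "nat \<Rightarrow> ('a::field, 'n::finite) mpoly \<Rightarrow> ('a, 'n) mpoly" where
  "component d f = Poly_Mapping.mapp (\<lambda>m a. if total_degree m = d then a else 0) f"

lemma lookup_component:
  "Poly_Mapping.lookup (component d f) m = (if total_degree m = d then Poly_Mapping.lookup f m else 0)"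
  by (simp add: component_def lookup_mapp when_def in_keys_iff)

lemma component_add: "component d (f + g) = component d f + component d g"
  by (rule poly_mapping_eqI) (simp add: lookup_component lookup_add)

lemma component_0 [simp]: "component d 0 = 0"
  by (rule poly_mapping_eqI) (simp add: lookup_component)

lemma component_sum: "component d (\<Sum>x\<in>S. F x) = (\<Sum>x\<in>S. component d (F x))"
  by (induction S rule: infinite_finite_induct) (simp_all add: component_add)

lemma homogeneous_component: "homogeneous d (component d f)"
  by (auto simp: homogeneous_def in_keys_iff lookup_component split: if_splits)

lemma component_homogeneous: "homogeneous e f \<Longrightarrow> component d f = (if d = e then f else 0)"
  by (rule poly_mapping_eqI) (auto simp: lookup_component homogeneous_def in_keys_iff)

lemma sum_components:
  "(\<Sum>d\<in>total_degree ` Poly_Mapping.keys f. component d f) = f"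
  by (rule poly_mapping_eqI) (auto simp: lookup_sum lookup_component in_keys_iff)

lemma component_lin: "component d (lin A f) = lin A (component d f)"
proof -
  let ?D = "total_degree ` Poly_Mapping.keys f"
  have "component d (lin A f) = component d (lin A (\<Sum>e\<in>?D. component e f))"
    by (simp only: sum_components)
  also have "\<dots> = (\<Sum>e\<in>?D. component d (lin A (component e f)))"
    by (simp only: lin_sum component_sum)
  also have "\<dots> = (\<Sum>e\<in>?D. if e = d then lin A (component d f) else 0)"
    by (rule sum.cong) (auto simp: component_homogeneous[OF homogeneous_lin[OF homogeneous_component]])
  also have "\<dots> = lin A (component d f)"
  proof (cases "d \<in> ?D")
    case False
    then have "component d f = 0"
      by (intro poly_mapping_eqI) (auto simp: lookup_component in_keys_iff)
    then show ?thesis by simp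
  qed simp
  finally show ?thesis .
qed

lemma zero_in_invariants_deg: "0 \<in> invariants_deg G d"
  by (simp add: invariants_deg_def invariants_def act_eq_lin)

text \<open>The case distinction in \<open>M\<close> concerns all invariants at once, the proofs
  work degree by degree. The two agree because substitution commutes with taking components, so each
  component of an invariant is invariant.\<close>

lemma invariants_eq_range_Const_iff:
  fixes G :: "('a::field ^ 'n::finite ^ 'n) set"
  shows "invariants G = range Const \<longleftrightarrow> (\<forall>d>0. invariants_deg G d = {0})"
proof
  assume G: "invariants G = range Const"
  show "\<forall>d>0. invariants_deg G d = {0}"
  proof (intro allI impI)
    fix d :: nat assume "d > 0"
    have "f = 0" if f: "f \<in> invariants_deg G d" for f
    proof -
      obtain c where c: "f = Const c" using f G by (auto simp: invariants_deg_def)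
      have "f = component d f" using f component_homogeneous[of d f d] by (simp add: invariants_deg_def)
      also have "\<dots> = 0" unfolding c component_homogeneous[OF homogeneous_Const] using \<open>d > 0\<close> by simp
      finally show ?thesis .
    qed
    then show "invariants_deg G d = {0}" using zero_in_invariants_deg by blast
  qed
next
  assume *: "\<forall>d>0. invariants_deg G d = {0}"
  have "f \<in> range Const" if f: "f \<in> invariants G" for f
  proof -
    have "component d f \<in> invariants_deg G d" for d
      using f by (simp add: invariants_deg_def invariants_def act_eq_lin component_lin[symmetric]
          homogeneous_component)
    then have 0: "component d f = 0" if "d > 0" for d using * that by blast
    have "f = Const (Poly_Mapping.lookup f 0)"
    proof (rule poly_mapping_eqI)
      fix m
      show "Poly_Mapping.lookup f m = Poly_Mapping.lookup (Const (Poly_Mapping.lookup f 0)) m"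
      proof (cases "m = 0")
        case False
        then have "total_degree m > 0" by (auto simp: poly_mapping_eq_iff fun_eq_iff intro!: sum_pos2)
        then show ?thesis
          using 0 lookup_component[of "total_degree m" f m] False
          by (simp add: Const_def lookup_single when_def)
      qed (simp add: Const_def)
    qed
    then show ?thesis by blast
  qed
  moreover have "Const c \<in> invariants G" for c
    by (simp add: invariants_def act_eq_lin)
  ultimately show "invariants G = range Const" by blast
qed

lemma M_cong:
  assumes "\<And>d. invariants_deg G d = {0} \<longleftrightarrow> invariants_deg H d = {0}"
  shows "M G = M H"
  unfolding M_def invariants_eq_range_Const_iff assms ..

lemma M_antimono:
  assumes "H \<subseteq> G"
  shows "M H \<le> M G"
proof (cases "invariants G = range Const")
  case True
  then show ?thesis by (simp add: M_def)
next
  case False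
  let ?P = "\<lambda>G d. d > 0 \<and> invariants_deg G d \<noteq> {0}"
  have sub: "invariants_deg G d \<subseteq> invariants_deg H d" for d
    using assms by (auto simp: invariants_deg_def invariants_def)
  have "\<exists>d. ?P G d" using False by (auto simp: invariants_eq_range_Const_iff)
  then have "?P G (LEAST d. ?P G d)" by (rule LeastI_ex)
  then have H: "?P H (LEAST d. ?P G d)" using sub zero_in_invariants_deg by blast
  then have "(LEAST d. ?P H d) \<le> (LEAST d. ?P G d)" by (rule Least_le)
  moreover have "invariants H \<noteq> range Const" using H by (auto simp: invariants_eq_range_Const_iff)
  ultimately show ?thesis using False by (simp add: M_def)
qed

section \<open>Fixed polynomials of generated subgroups\<close>

lemma group_GL: "group (GL :: ('a::field ^ 'n::finite ^ 'n) monoid)"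
proof (rule groupI)
  fix x :: "'a ^ 'n ^ 'n" assume "x \<in> carrier GL"
  then have "matrix_inv x \<in> carrier GL \<and> matrix_inv x \<otimes>\<^bsub>GL\<^esub> x = \<one>\<^bsub>GL\<^esub>"
    by (simp add: GL_def invertible_matrix_inv matrix_inv_left)
  then show "\<exists>y\<in>carrier GL. y \<otimes>\<^bsub>GL\<^esub> x = \<one>\<^bsub>GL\<^esub>" by blast
next
  have "invertible (mat 1 :: 'a ^ 'n ^ 'n)" unfolding invertible_def by (rule exI[of _ "mat 1"]) simp
  then show "\<one>\<^bsub>GL\<^esub> \<in> carrier (GL :: ('a ^ 'n ^ 'n) monoid)" by (simp add: GL_def)
qed (simp_all add: GL_def matrix_mul_assoc invertible_mult)

lemma inv_GL:
  assumes "g \<in> carrier (GL :: ('a::field ^ 'n::finite ^ 'n) monoid)"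
  shows "inv\<^bsub>GL\<^esub> g = matrix_inv g"
  using assms
  by (intro group.inv_equality[OF group_GL])
     (simp_all add: GL_def invertible_matrix_inv matrix_inv_left)

lemma lin_matrix_inv_fixed_iff:
  assumes "invertible g"
  shows "lin (matrix_inv g) f = f \<longleftrightarrow> lin g f = f"
  using assms by (metis lin_mat_1 lin_matrix_mult matrix_inv_left matrix_inv_right)

lemma invariants_subgroup:
  assumes "H \<subseteq> carrier GL"
  shows "invariants H = {f. \<forall>h\<in>H. lin h f = f}"
  using assms by (auto simp: invariants_def act_eq_lin GL_def lin_matrix_inv_fixed_iff subset_iff)

lemma invariants_generate:
  fixes S :: "('a::field ^ 'n::finite ^ 'n) set"
  assumes S: "S \<subseteq> carrier GL"
  shows "invariants (generate GL S) = {f. \<forall>h\<in>S. lin h f = f}"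
proof -
  have gen: "generate GL S \<subseteq> carrier GL" by (rule group.generate_incl[OF group_GL S])
  have "lin h f = f" if f: "\<forall>h\<in>S. lin h f = f" and h: "h \<in> generate GL S" for f h
    using h
  proof (induction h rule: generate.induct)
    case (inv h)
    then have h: "h \<in> carrier GL" using S by blast
    then have "invertible h" by (simp add: GL_def)
    then show ?case using f inv unfolding inv_GL[OF h] by (simp add: lin_matrix_inv_fixed_iff)
  next
    case (eng h1 h2)
    then show ?case by (simp add: GL_def lin_matrix_mult)
  qed (use f in \<open>simp_all add: GL_def\<close>)
  then show ?thesis
    unfolding invariants_subgroup[OF gen] using generate.incl[of _ S GL] by blast
qed

lemma semisimple_parts_carrier: "semisimple_parts H \<subseteq> carrier GL"
  by (auto simp: semisimple_parts_def jordan_chevalley_def)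

lemma invariants_deg_generate_semisimple_parts:
  fixes H :: "('a::field ^ 'n::finite ^ 'n) set"
  shows "invariants_deg (generate GL (semisimple_parts H)) d
    = {f. homogeneous d f \<and> (\<forall>s\<in>semisimple_parts H. lin s f = f)}"
  by (auto simp: invariants_deg_def invariants_generate[OF semisimple_parts_carrier])

text \<open>For each \<open>h\<close> in \<open>T\<close> in turn, the last nonzero vector of the form \<open>(h - 1)\<^sup>j f\<close> is fixed by
  \<open>h\<close>, and still fixed by its predecessors.\<close>

lemma common_fixed_vector:
  fixes H T :: "('a::field ^ 'n::finite ^ 'n) set"
  assumes perf: "perfect TYPE('a)" and H: "H \<subseteq> carrier GL"
    and comm: "\<And>g h. g \<in> H \<Longrightarrow> h \<in> H \<Longrightarrow> g ** h = h ** g"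
    and f0: "f0 \<in> invariants_deg (generate GL (semisimple_parts H)) d" "f0 \<noteq> 0"
    and "finite T" "T \<subseteq> H"
  shows "\<exists>f\<in>invariants_deg (generate GL (semisimple_parts H)) d. f \<noteq> 0 \<and> (\<forall>h\<in>T. lin h f = f)"
  using \<open>finite T\<close> \<open>T \<subseteq> H\<close>
proof (induction T rule: finite_induct)
  case empty
  then show ?case using f0 by blast
next
  case (insert h T)
  let ?W = "invariants_deg (generate GL (semisimple_parts H)) d"
  obtain f where f: "f \<in> ?W" "f \<noteq> 0" "\<forall>h\<in>T. lin h f = f" using insert by blast
  have h: "h \<in> H" using insert.prems by blast
  obtain s u where jc: "jordan_chevalley h s u"
    using jordan_chevalley_exists[OF perf, of h] h H by (auto simp: GL_def)
  then have s: "s \<in> semisimple_parts H" using h by (auto simp: semisimple_parts_def)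
  have su: "h = s ** u" "h = u ** s" and uni: "unipotent u" using jc by (auto simp: jordan_chevalley_def)
  have lin_comm: "lin A (lin B g) = lin B (lin A g)" if "A ** B = B ** A" for A B and g :: "('a, 'n) mpoly"
    using that by (metis lin_matrix_mult)
  have pev_comm: "lin A (lo.pev B p g) = lo.pev B p (lin A g)" if "A ** B = B ** A"
    for A B p and g :: "('a, 'n) mpoly"
    by (rule pev_commute[OF lo.lin_op_axioms lo.lin_op_axioms]) (rule lin_comm[OF that])
  have sf: "lin s f = f" using f(1) s by (simp add: invariants_deg_generate_semisimple_parts)
  \<comment> \<open>As \<open>s\<close> fixes \<open>f\<close> and commutes with \<open>u\<close>,
    it fixes all iterates (u - 1)^j f, on which \<open>h\<close> therefore acts as \<open>u\<close>
    does.\<close>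
  have eq: "lo.pev h ([:- 1, 1:] ^ j) f = lo.pev u ([:- 1, 1:] ^ j) f" for j
  proof (induction j)
    case (Suc j)
    let ?g = "lo.pev u ([:- 1, 1:] ^ j) f"
    have "lin s ?g = ?g" using pev_comm[of s u] su sf by simp
    then have "lin h ?g = lin u ?g" by (simp add: su(1) lin_matrix_mult)
    then have "lo.pev h [:- 1, 1:] ?g = lo.pev u [:- 1, 1:] ?g" by (simp add: lo.pev_linear)
    then show ?case by (simp only: power_Suc lo.pev_mult Suc.IH)
  qed simp
  obtain k where k: "lo.pev h ([:- 1, 1:] ^ k) f = 0"
    using unipotent_lin_nilpotent[OF uni, of f] eq by auto
  define j where "j = (LEAST j. lo.pev h ([:- 1, 1:] ^ j) f = 0)"
  have j0: "lo.pev h ([:- 1, 1:] ^ j) f = 0" unfolding j_def using k by (rule LeastI)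
  with f(2) have "j \<noteq> 0" by (intro notI) simp
  then obtain i where i: "j = Suc i" by (meson not0_implies_Suc)
  define g where "g = lo.pev h ([:- 1, 1:] ^ i) f"
  have "g \<noteq> 0" unfolding g_def 
    using not_less_Least[of i "\<lambda>j. lo.pev h ([:- 1, 1:] ^ j) f = 0"] i unfolding j_def[symmetric]
    by simp
  moreover have "lin h g = g"
  proof -
    have "lo.pev h [:- 1, 1:] g = 0" using j0 unfolding i g_def power_Suc lo.pev_mult .
    then show ?thesis by simp
  qed
  moreover have "lin t g = g" if "t \<in> T" for t
    unfolding g_def using pev_comm[of t h] comm[of t h] f(3) that insert.prems by auto
  moreover have "g \<in> ?W"
  proof -
    have "mp.subspace {f. homogeneous d f}"
      by (rule mp.subspaceI) (auto intro: homogeneous_add homogeneous_Const_mult)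
    then have "homogeneous d g"
      unfolding g_def using lo.pev_subspace[of "{f. homogeneous d f}" h f] f(1)
      by (auto simp: invariants_deg_def homogeneous_lin)
    moreover have "lin s' g = g" if s': "s' \<in> semisimple_parts H" for s'
    proof -
      obtain h' u' where h': "h' \<in> H" "jordan_chevalley h' s' u'"
        using s' by (auto simp: semisimple_parts_def)
      \<comment> \<open>The semisimple part \<open>s'\<close> is a polynomial in \<open>h'\<close>,
        with which \<open>h\<close> commutes; hence applying polynomials in \<open>h\<close>
        preserves invariance under \<open>s'\<close>.\<close>
      have "h ** s' = s' ** h"
        by (rule semisimple_part_commute[OF perf h'(2)]) (rule comm[OF h h'(1)])
      then show ?thesis
        unfolding g_def using pev_comm[of s' h] f(1) s'
        by (simp add: invariants_deg_generate_semisimple_parts)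
    qed
    ultimately show ?thesis by (simp add: invariants_deg_generate_semisimple_parts)
  qed
  ultimately show ?case by blast
qed

lemma M_generate_semisimple_parts:
  fixes H :: "('a::field ^ 'n::finite ^ 'n) set"
  assumes perf: "perfect TYPE('a)" and H: "fg_abelian_subgroup H"
  shows "M H = M (generate GL (semisimple_parts H))"
proof (rule M_cong)
  fix d
  obtain S where S: "finite S" "S \<subseteq> carrier GL" "generate GL S = H"
    using H by (auto simp: fg_abelian_subgroup_def fg_subgroup_def)
  have Hc: "H \<subseteq> carrier GL" using group.generate_incl[OF group_GL S(2)] S(3) by simp
  have SH: "S \<subseteq> H" using S(3) generate.incl[of _ S GL] by blast
  have comm: "g ** h = h ** g" if "g \<in> H" "h \<in> H" for g h
  proof -
    interpret comm_group "GL\<lparr>carrier := H\<rparr>" using H by (simp add: fg_abelian_subgroup_def)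
    show ?thesis using m_comm[of g h] that by (simp add: GL_def)
  qed
  let ?G = "generate GL (semisimple_parts H)"
  have "invariants_deg H d \<subseteq> invariants_deg ?G d"
  proof
    fix f assume f: "f \<in> invariants_deg H d"
    have "lin s f = f" if s: "s \<in> semisimple_parts H" for s
    proof -
      obtain h u where h: "h \<in> H" "jordan_chevalley h s u"
        using s by (auto simp: semisimple_parts_def)
      then have "lin h f = f" using f by (simp add: invariants_deg_def invariants_subgroup[OF Hc])
      with perf h(2) show ?thesis by (rule invariant_under_semisimple_part)
    qed
    then show "f \<in> invariants_deg ?G d"
      using f by (simp add: invariants_deg_generate_semisimple_parts) (simp add: invariants_deg_def)
  qed
  moreover have "\<exists>f\<in>invariants_deg H d. f \<noteq> 0" if f0: "f0 \<in> invariants_deg ?G d" "f0 \<noteq> 0" for f0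
  proof -
    \<comment> \<open>Finite generation enters here: the finite set \<open>S\<close> admits the
      induction, and a polynomial fixed by \<open>S\<close> is fixed by all of
      \<open>H\<close>.\<close>
    obtain f where "f \<in> invariants_deg ?G d" "f \<noteq> 0" "\<forall>h\<in>S. lin h f = f"
      using common_fixed_vector[OF perf Hc comm f0 S(1) SH] by blast
    moreover then have "f \<in> invariants_deg H d"
      using invariants_generate[OF S(2)] S(3) by (simp add: invariants_deg_def)
    ultimately show ?thesis by blast
  qed
  ultimately show "invariants_deg H d = {0} \<longleftrightarrow> invariants_deg ?G d = {0}"
    using zero_in_invariants_deg[of H d] zero_in_invariants_deg[of ?G d] by blast
qed

theorem lemma3p2:
  assumes "perfect TYPE('a::field)"
  shows "(\<forall>H :: ('a ^ 'n::finite ^ 'n) set.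
            fg_abelian_subgroup H \<longrightarrow> M H = M (generate GL (semisimple_parts H)))
       \<and> (\<forall>(G :: ('a ^ 'n ^ 'n) set) H.
            fg_subgroup G \<and> fg_abelian_subgroup H \<and> H \<subseteq> G
            \<longrightarrow> M (generate GL (semisimple_parts H)) \<le> M G)"
  using M_generate_semisimple_parts[OF assms] M_antimono by metis

end
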